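(* Let $q\ge 0$ and let $t$ be a filtration value. The classes $\{[z_v]_t \mid v\in\mathcal S_t^{(q)}\}$ form a basis of $\operatorname{im}(i_t)_*\subseteq H_q(K_t;\Bbbk)$, where $(i_t)_*:H_q(K_{t^-};\Bbbk)\to H_q(K_t;\Bbbk)$ is induced by the inclusion $i_t:K_{t^-}\hookrightarrow K_t$.
   Context: $K$ is a finite CW complex with fixed cell orientations and set of open cells $\mathcal K$; $\Bbbk$ is a field. $C_q$, $\partial_q$, $H_q$ denote cellular chains, boundary and homology with coefficients in $\Bbbk$. A filtration function $f:\mathcal K\to\mathbb R$ is fixed, i.e. $\tau\subseteq\overline\sigma$ implies $f(\tau)\le f(\sigma)$; its values are called filtration values. $K_t$ (resp. $K_{t^-}$) is the union of the cells $\sigma$ with $f(\sigma)\le t$ (resp. $f(\sigma)<t$). The cells are totally ordered $\sigma_1\prec\dots\prec\sigma_N$ so that $f(\sigma_i)<f(\sigma_j)$ implies $i<j$, and $\sigma_i\subseteq\overline{\sigma_j}$, $\sigma_i\ne\sigma_j$ implies $i<j$. The sets $K_t$, $K_{t^-}$ and $\bigcup_{\ell\le p}\sigma_\ell$ are CW subcomplexes. The boundary matrix $D\in\Bbbk^{N\times N}$ has entries $D_{ij}=[\sigma_j:\sigma_i]$ (cellular incidence coefficients), so its $j$-th column is the coordinate vector of $\partial\sigma_j$. For a nonzero column $c$, $\operatorname{low}(c)=\max\{i\mid c_i\neq 0\}$. A matrix is reduced if no two of its nonzero columns have the same low. Fix a factorization $R=DV$ with $R$ reduced and $V$ upper unitriangular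 and dimension preserving (column $V_i$ is supported only on cells of the same dimension as $\sigma_i$). Columns are identified with cellular chains. A cell $\sigma_i$ is positive if $R_i=0$; then $z_i:=V_i$ is its selected birth cycle. For positive $\sigma_i$, $\operatorname{pair}(i)=j$ if $\operatorname{low}(R_j)=i$ for some (necessarily unique) $j$ with $R_j\ne0$, and $\operatorname{pair}(i)=\infty$ otherwise. $\mathcal V^{(q)}$ is the set of labeled nonzero $q$-th persistence intervals: each $u\in\mathcal V^{(q)}$ corresponds to a positive $q$-cell with index $i(u)$, with $b_u=f(\sigma_{i(u)})$, $d_u=f(\sigma_{\operatorname{pair}(i(u))})$ if $\operatorname{pair}(i(u))<\infty$ and $d_u=\infty$ otherwise, and only those with $b_u<d_u$ are included. The interval is $I_u=[b_u,d_u)$, and $z_u:=z_{i(u)}$. Define $\mathcal S_t^{(q)}=\{v\in\mathcal V^{(q)}\mid b_v<t<d_v\}$. $[\cdot]_t$ and $[\cdot]_{t^-}$ denote classes in $H_q(K_t;\Bbbk)$ and $H_q(K_{t^-};\Bbbk)$. *)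

theory Defs
  imports
    "HOL-Homology.Homology"
    "HOL-Library.Extended_Real"
    "HOL-Library.Extended_Nat"
    "Jordan_Normal_Form.Matrix"
    "Jordan_Normal_Form.VS_Connect"
begin

section \<open>Finite CW complexes with oriented cells\<close>

definition unit_disc :: "nat \<Rightarrow> (nat \<Rightarrow> real) topology" where
  "unit_disc n = subtopology (Euclidean_space n) {x. (\<Sum>i<n. (x i)\<^sup>2) \<le> 1}"

text \<open>The boundary sphere; it is empty for \<open>n = 0\<close>.\<close>

definition unit_disc_boundary :: "nat \<Rightarrow> (nat \<Rightarrow> real) set" where
  "unit_disc_boundary n = {x \<in> topspace (unit_disc n). (\<Sum>i<n. (x i)\<^sup>2) = 1}"

text \<open>The cells are the open cells, as subsets of the space. The orientation of an
  \<open>n\<close>-cell is given by a generator of $H_n(D^n, S^{n-1}; \mathbb Z)$, transported by the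
  characteristic map.\<close>

record 'a cw_complex =
  cw_space :: "'a topology"
  cw_cells :: "'a set set"
  cw_dim :: "'a set \<Rightarrow> nat"
  cw_map :: "'a set \<Rightarrow> (nat \<Rightarrow> real) \<Rightarrow> 'a"
  cw_orient :: "'a set \<Rightarrow> (nat \<Rightarrow> real) chain set"

text \<open>The index is an integer, so that the skeleta of index \<open>-1\<close> and \<open>-2\<close> are available
  (and empty).\<close>

definition skeleton :: "'a cw_complex \<Rightarrow> int \<Rightarrow> 'a set" where
  "skeleton K n = \<Union>{\<sigma> \<in> cw_cells K. int (cw_dim K \<sigma>) \<le> n}"

text \<open>Since there are finitely many cells, closure finiteness and the weak topology are
  automatic.\<close>

definition finite_cw_complex :: "'a cw_complex \<Rightarrow> bool" where
  "finite_cw_complex K \<longleftrightarrow>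
     Hausdorff_space (cw_space K) \<and>
     finite (cw_cells K) \<and>
     pairwise disjnt (cw_cells K) \<and>
     \<Union>(cw_cells K) = topspace (cw_space K) \<and>
     (\<forall>\<sigma>\<in>cw_cells K.
        continuous_map (unit_disc (cw_dim K \<sigma>)) (cw_space K) (cw_map K \<sigma>) \<and>
        homeomorphic_map
          (subtopology (unit_disc (cw_dim K \<sigma>))
             (topspace (unit_disc (cw_dim K \<sigma>)) - unit_disc_boundary (cw_dim K \<sigma>)))
          (subtopology (cw_space K) \<sigma>) (cw_map K \<sigma>) \<and>
        cw_map K \<sigma> ` unit_disc_boundary (cw_dim K \<sigma>) \<subseteq> skeleton K (int (cw_dim K \<sigma>) - 1))"

definition oriented_cells :: "'a cw_complex \<Rightarrow> bool" where
  "oriented_cells K \<longleftrightarrow>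
     (\<forall>\<sigma>\<in>cw_cells K.
        let H = relative_homology_group (int (cw_dim K \<sigma>))
                  (unit_disc (cw_dim K \<sigma>)) (unit_disc_boundary (cw_dim K \<sigma>))
        in cw_orient K \<sigma> \<in> carrier H \<and> generate H {cw_orient K \<sigma>} = carrier H)"

section \<open>The cellular boundary and incidence coefficients\<close>

text \<open>\<open>cellular_group K n\<close> is $H_n(K^n, K^{n-1}; \mathbb Z)$, and \<open>cell_class K \<sigma>\<close> is the
  element of it given by the oriented cell \<open>\<sigma>\<close> of dimension \<open>n\<close>.\<close>

definition cellular_group :: "'a cw_complex \<Rightarrow> int \<Rightarrow> 'a chain set monoid" where
  "cellular_group K n =
     relative_homology_group n (subtopology (cw_space K) (skeleton K n)) (skeleton K (n - 1))"

definition cell_class :: "'a cw_complex \<Rightarrow> 'a set \<Rightarrow> 'a chain set" where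
  "cell_class K \<sigma> =
     hom_induced (int (cw_dim K \<sigma>))
       (unit_disc (cw_dim K \<sigma>)) (unit_disc_boundary (cw_dim K \<sigma>))
       (subtopology (cw_space K) (skeleton K (int (cw_dim K \<sigma>))))
       (skeleton K (int (cw_dim K \<sigma>) - 1))
       (cw_map K \<sigma>) (cw_orient K \<sigma>)"

text \<open>The composite
  $H_n(K^n, K^{n-1}) \to H_{n-1}(K^{n-1}) \to H_{n-1}(K^{n-1}, K^{n-2})$. Its codomain is
  \<open>cellular_group K (n - 1)\<close>, because the \<open>(n-1)\<close>-skeleton is contained in the \<open>n\<close>-skeleton.\<close>

definition cellular_boundary_map :: "'a cw_complex \<Rightarrow> int \<Rightarrow> 'a chain set \<Rightarrow> 'a chain set" where
  "cellular_boundary_map K n =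
     hom_relboundary n (subtopology (cw_space K) (skeleton K n))
       (skeleton K (n - 1)) (skeleton K (n - 2))"

text \<open>\<open>inc \<sigma> \<tau>\<close> is $[\sigma:\tau]$. The homology groups are written multiplicatively, so the
  equation below reads $\partial\sigma = \sum_\tau [\sigma:\tau]\,\tau$. It determines \<open>inc\<close>
  uniquely, as the classes of the oriented \<open>n\<close>-cells form a basis of the free abelian group
  $H_n(K^n, K^{n-1}; \mathbb Z)$.\<close>

definition incidence_coefficients :: "'a cw_complex \<Rightarrow> ('a set \<Rightarrow> 'a set \<Rightarrow> int) \<Rightarrow> bool" where
  "incidence_coefficients K inc \<longleftrightarrow>
     (\<forall>\<sigma> \<tau>. inc \<sigma> \<tau> \<noteq> 0 \<longrightarrow>
        \<sigma> \<in> cw_cells K \<and> \<tau> \<in> cw_cells K \<and> cw_dim K \<sigma> = Suc (cw_dim K \<tau>)) \<and>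
     (\<forall>\<sigma>\<in>cw_cells K.
        let n = int (cw_dim K \<sigma>); G = cellular_group K (n - 1)
        in cellular_boundary_map K n (cell_class K \<sigma>) =
           finprod G (\<lambda>\<tau>. cell_class K \<tau> [^]\<^bsub>G\<^esub> inc \<sigma> \<tau>)
             {\<tau> \<in> cw_cells K. int (cw_dim K \<tau>) = n - 1})"

section \<open>Cellular homology with coefficients in a field\<close>

text \<open>A subcomplex is given by its set \<open>L\<close> of cells. Chains over the field are coefficient
  functions on cells. The definitions only need \<open>L\<close> to contain every \<open>\<tau>\<close> with
  $[\sigma:\tau] \neq 0$ for some \<open>\<sigma>\<close> in \<open>L\<close>; such \<open>\<tau>\<close> lies in the closure of \<open>\<sigma>\<close>.\<close>

definition cell_chains :: "'a cw_complex \<Rightarrow> nat \<Rightarrow> 'a set set \<Rightarrow> ('a set \<Rightarrow> 'k::field) set" where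
  "cell_chains K q L = {c. \<forall>\<sigma>. c \<sigma> \<noteq> 0 \<longrightarrow> \<sigma> \<in> L \<and> cw_dim K \<sigma> = q}"

definition chain_boundary ::
  "'a cw_complex \<Rightarrow> ('a set \<Rightarrow> 'a set \<Rightarrow> int) \<Rightarrow> ('a set \<Rightarrow> 'k::field) \<Rightarrow> 'a set \<Rightarrow> 'k" where
  "chain_boundary K inc c = (\<lambda>\<tau>. \<Sum>\<sigma>\<in>cw_cells K. c \<sigma> * of_int (inc \<sigma> \<tau>))"

definition cell_cycles ::
  "'a cw_complex \<Rightarrow> ('a set \<Rightarrow> 'a set \<Rightarrow> int) \<Rightarrow> nat \<Rightarrow> 'a set set \<Rightarrow> ('a set \<Rightarrow> 'k::field) set" where
  "cell_cycles K inc q L = {c \<in> cell_chains K q L. chain_boundary K inc c = (\<lambda>_. 0)}"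

definition cell_boundaries ::
  "'a cw_complex \<Rightarrow> ('a set \<Rightarrow> 'a set \<Rightarrow> int) \<Rightarrow> nat \<Rightarrow> 'a set set \<Rightarrow> ('a set \<Rightarrow> 'k::field) set" where
  "cell_boundaries K inc q L = chain_boundary K inc ` cell_chains K (Suc q) L"

definition homology_class ::
  "'a cw_complex \<Rightarrow> ('a set \<Rightarrow> 'a set \<Rightarrow> int) \<Rightarrow> nat \<Rightarrow> 'a set set
     \<Rightarrow> ('a set \<Rightarrow> 'k::field) \<Rightarrow> ('a set \<Rightarrow> 'k) set" where
  "homology_class K inc q L z = {\<lambda>\<sigma>. z \<sigma> + b \<sigma> |b. b \<in> cell_boundaries K inc q L}"

text \<open>The quotient vector space of cycles by boundaries, with cosets as elements. Adding the
  boundaries in the scalar multiplication only matters for the scalar \<open>0\<close>. The components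
  \<open>mult\<close> and \<open>one\<close> of the record play no role in a module.\<close>

definition cellular_homology ::
  "'a cw_complex \<Rightarrow> ('a set \<Rightarrow> 'a set \<Rightarrow> int) \<Rightarrow> nat \<Rightarrow> 'a set set
     \<Rightarrow> ('k::field, ('a set \<Rightarrow> 'k) set) module" where
  "cellular_homology K inc q L =
     \<lparr>carrier = homology_class K inc q L ` cell_cycles K inc q L,
      monoid.mult = undefined, one = undefined,
      zero = cell_boundaries K inc q L,
      add = (\<lambda>A B. {\<lambda>\<sigma>. a \<sigma> + b \<sigma> |a b. a \<in> A \<and> b \<in> B}),
      smult = (\<lambda>r A. {\<lambda>\<sigma>. r * a \<sigma> + b \<sigma> |a b. a \<in> A \<and> b \<in> cell_boundaries K inc q L})\<rparr>"

text \<open>The map into the homology of \<open>L\<close> induced by the inclusion of a smaller subcomplex; it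
  sends the class of a cycle \<open>z\<close> to the class of \<open>z\<close> in \<open>L\<close>.\<close>

definition inclusion_induced ::
  "'a cw_complex \<Rightarrow> ('a set \<Rightarrow> 'a set \<Rightarrow> int) \<Rightarrow> nat \<Rightarrow> 'a set set
     \<Rightarrow> ('a set \<Rightarrow> 'k::field) set \<Rightarrow> ('a set \<Rightarrow> 'k) set" where
  "inclusion_induced K inc q L A = (\<Union>z\<in>A. homology_class K inc q L z)"

section \<open>Filtrations\<close>

definition filtration_function :: "'a cw_complex \<Rightarrow> ('a set \<Rightarrow> real) \<Rightarrow> bool" where
  "filtration_function K f \<longleftrightarrow>
     (\<forall>\<sigma>\<in>cw_cells K. \<forall>\<tau>\<in>cw_cells K. \<tau> \<subseteq> cw_space K closure_of \<sigma> \<longrightarrow> f \<tau> \<le> f \<sigma>)"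

definition sublevel :: "'a cw_complex \<Rightarrow> ('a set \<Rightarrow> real) \<Rightarrow> real \<Rightarrow> 'a set set" where
  "sublevel K f t = {\<sigma> \<in> cw_cells K. f \<sigma> \<le> t}"

definition strict_sublevel :: "'a cw_complex \<Rightarrow> ('a set \<Rightarrow> real) \<Rightarrow> real \<Rightarrow> 'a set set" where
  "strict_sublevel K f t = {\<sigma> \<in> cw_cells K. f \<sigma> < t}"

text \<open>The total order on the cells is an enumeration; positions, and hence rows and columns
  of matrices, are counted from 0.\<close>

definition filtration_order :: "'a cw_complex \<Rightarrow> ('a set \<Rightarrow> real) \<Rightarrow> 'a set list \<Rightarrow> bool" where
  "filtration_order K f cs \<longleftrightarrow>
     distinct cs \<and> set cs = cw_cells K \<and>
     (\<forall>i<length cs. \<forall>j<length cs.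
        (f (cs ! i) < f (cs ! j) \<longrightarrow> i < j) \<and>
        (cs ! i \<subseteq> cw_space K closure_of (cs ! j) \<and> cs ! i \<noteq> cs ! j \<longrightarrow> i < j))"

section \<open>Matrix reduction\<close>

text \<open>Column \<open>j\<close> is the coordinate vector of the boundary of the \<open>j\<close>-th cell.\<close>

definition boundary_matrix ::
  "('a set \<Rightarrow> 'a set \<Rightarrow> int) \<Rightarrow> 'a set list \<Rightarrow> 'k::field mat" where
  "boundary_matrix inc cs =
     mat (length cs) (length cs) (\<lambda>(i, j). of_int (inc (cs ! j) (cs ! i)))"

text \<open>Only meaningful for nonzero vectors.\<close>

definition low :: "'k::zero vec \<Rightarrow> nat" where
  "low c = Max {i. i < dim_vec c \<and> c $ i \<noteq> 0}"

definition reduced_matrix :: "'k::zero mat \<Rightarrow> bool" where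
  "reduced_matrix R \<longleftrightarrow>
     (\<forall>i<dim_col R. \<forall>j<dim_col R.
        col R i \<noteq> 0\<^sub>v (dim_row R) \<and> col R j \<noteq> 0\<^sub>v (dim_row R) \<and> low (col R i) = low (col R j)
          \<longrightarrow> i = j)"

definition upper_unitriangular :: "'k::{zero,one} mat \<Rightarrow> bool" where
  "upper_unitriangular V \<longleftrightarrow> upper_triangular V \<and> (\<forall>i<dim_row V. V $$ (i, i) = 1)"

definition dimension_preserving :: "'a cw_complex \<Rightarrow> 'a set list \<Rightarrow> 'k::zero mat \<Rightarrow> bool" where
  "dimension_preserving K cs V \<longleftrightarrow>
     (\<forall>i<length cs. \<forall>j<length cs. V $$ (i, j) \<noteq> 0 \<longrightarrow> cw_dim K (cs ! i) = cw_dim K (cs ! j))"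

definition column_chain :: "'a set list \<Rightarrow> 'k::field vec \<Rightarrow> 'a set \<Rightarrow> 'k" where
  "column_chain cs c = (\<lambda>\<sigma>. \<Sum>i<length cs. if cs ! i = \<sigma> then c $ i else 0)"

definition positive :: "'k::zero mat \<Rightarrow> nat \<Rightarrow> bool" where
  "positive R i \<longleftrightarrow> col R i = 0\<^sub>v (dim_row R)"

definition birth_cycle :: "'a set list \<Rightarrow> 'k::field mat \<Rightarrow> nat \<Rightarrow> 'a set \<Rightarrow> 'k" where
  "birth_cycle cs V i = column_chain cs (col V i)"

definition pairs_with :: "'k::zero mat \<Rightarrow> nat \<Rightarrow> nat \<Rightarrow> bool" where
  "pairs_with R i j \<longleftrightarrow> j < dim_col R \<and> col R j \<noteq> 0\<^sub>v (dim_row R) \<and> low (col R j) = i"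

definition pair :: "'k::zero mat \<Rightarrow> nat \<Rightarrow> enat" where
  "pair R i = (if \<exists>j. pairs_with R i j then enat (THE j. pairs_with R i j) else \<infinity>)"

section \<open>Persistence intervals\<close>

text \<open>A labeled interval \<open>u\<close> is represented by the index \<open>i(u)\<close> of its positive cell.\<close>

definition birth :: "('a set \<Rightarrow> real) \<Rightarrow> 'a set list \<Rightarrow> nat \<Rightarrow> real" where
  "birth f cs i = f (cs ! i)"

definition death :: "('a set \<Rightarrow> real) \<Rightarrow> 'a set list \<Rightarrow> 'k::zero mat \<Rightarrow> nat \<Rightarrow> ereal" where
  "death f cs R i = (case pair R i of enat j \<Rightarrow> ereal (f (cs ! j)) | \<infinity> \<Rightarrow> \<infinity>)"

definition persistence_intervals ::
  "'a cw_complex \<Rightarrow> ('a set \<Rightarrow> real) \<Rightarrow> 'a set list \<Rightarrow> 'k::zero mat \<Rightarrow> nat \<Rightarrow> nat set" where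
  "persistence_intervals K f cs R q =
     {i. i < length cs \<and> cw_dim K (cs ! i) = q \<and> positive R i \<and>
         ereal (birth f cs i) < death f cs R i}"

definition intervals_through ::
  "'a cw_complex \<Rightarrow> ('a set \<Rightarrow> real) \<Rightarrow> 'a set list \<Rightarrow> 'k::zero mat \<Rightarrow> nat \<Rightarrow> real \<Rightarrow> nat set" where
  "intervals_through K f cs R q t =
     {v \<in> persistence_intervals K f cs R q. birth f cs v < t \<and> ereal t < death f cs R v}"

end

theory Submission
  imports Defs
begin

text \<open>Everything rests on comparing lowest nonzero positions. Since \<open>V\<close> is unitriangular, its columns are
  a basis of the chains on every initial segment of the cell order; as the nonzero columns of
  \<open>R\<close> have distinct lows, the positive columns of \<open>V\<close> are a basis of the cycles there. A combination of the
  \<open>z\<^sub>v\<close> with \<open>v\<close> in \<open>S\<^sub>t\<close> that bounds in \<open>K\<^sub>t\<close> is a combination of nonzero columns \<open>R\<^sub>j\<close> with \<open>f(\<sigma>\<^sub>j) \<le> t\<close>,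
  whose lows are never such \<open>v\<close>, so it vanishes. A birth cycle \<open>z\<^sub>i\<close> of a cell born before \<open>t\<close> and dying
  by \<open>t\<close> can be pushed below \<open>i\<close> by subtracting a multiple of the boundary \<open>R\<^sub>j\<close> with low \<open>i\<close>; the result is again a
  cycle because \<open>\<partial>\<partial> = 0\<close>.

  The relation \<open>\<partial>\<partial> = 0\<close> for the incidence coefficients comes from the exact sequences of the skeleta once
  the classes of the \<open>n\<close>-cells are known to be independent in $H_n(K^n, K^{n-1})$. Independence is
  detected by the local homology at the centre of each cell.\<close>

section \<open>The closed unit disc\<close>

text \<open>\<open>Euclidean_space n\<close> is a subspace of the product topology on sequences.
  Through \<open>top_of_set\<close> the type class notions \<open>closed\<close>,
  \<open>compact\<close> and \<open>continuous_on\<close> become available for the disc.\<close>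

lemma unit_disc_eq_top_of_set:
  "unit_disc n = top_of_set {x. (\<forall>i\<ge>n. x i = 0) \<and> (\<Sum>i<n. (x i)\<^sup>2) \<le> 1}"
  by (simp add: unit_disc_def Euclidean_space_def euclidean_product_topology
      subtopology_subtopology Collect_conj_eq)

lemma topspace_unit_disc:
  "topspace (unit_disc n) = {x. (\<forall>i\<ge>n. x i = 0) \<and> (\<Sum>i<n. (x i)\<^sup>2) \<le> 1}"
  by (simp add: unit_disc_eq_top_of_set)

text \<open>All coordinates of a point of the disc lie in [-1, 1], so the disc is a closed subset of
  a product of compact intervals.\<close>

lemma compact_space_unit_disc: "compact_space (unit_disc n)"
proof -
  let ?D = "{x::nat \<Rightarrow> real. (\<forall>i\<ge>n. x i = 0) \<and> (\<Sum>i<n. (x i)\<^sup>2) \<le> 1}"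
  have cl: "closed ?D"
  proof -
    have "closed {x::nat \<Rightarrow> real. x i = 0}" for i
      by (intro closed_Collect_eq continuous_intros) auto
    moreover have "closed {x::nat \<Rightarrow> real. (\<Sum>i<n. (x i)\<^sup>2) \<le> 1}"
      by (intro closed_Collect_le continuous_intros) auto
    ultimately have "closed ((\<Inter>i\<in>{n..}. {x::nat \<Rightarrow> real. x i = 0}) \<inter> {x. (\<Sum>i<n. (x i)\<^sup>2) \<le> 1})"
      by (intro closed_Int closed_INT ballI)
    moreover have "?D = (\<Inter>i\<in>{n..}. {x. x i = 0}) \<inter> {x. (\<Sum>i<n. (x i)\<^sup>2) \<le> 1}" by auto
    ultimately show ?thesis by metis
  qed
  have sub: "?D \<subseteq> PiE UNIV (\<lambda>_. {-1..1})"
  proof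
    fix x assume x: "x \<in> ?D"
    have "x i \<in> {-1..1}" for i
    proof (cases "i < n")
      case True
      have "(x i)\<^sup>2 \<le> (\<Sum>i<n. (x i)\<^sup>2)" using True by (intro member_le_sum) auto
      then have "(x i)\<^sup>2 \<le> 1" using x by auto
      then show ?thesis by (simp add: abs_square_le_1 abs_le_iff)
    next
      case False then show ?thesis using x by auto
    qed
    then show "x \<in> PiE UNIV (\<lambda>_. {-1..1})" by auto
  qed
  have "compact (PiE UNIV (\<lambda>_::nat. {-1..1::real}))"
    using compactin_PiE[of "\<lambda>_::nat. euclideanreal" UNIV "\<lambda>_. {-1..1}"]
    by (simp add: euclidean_product_topology)
  then have "compact (PiE UNIV (\<lambda>_::nat. {-1..1::real}) \<inter> ?D)"
    using cl by (rule compact_Int_closed)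
  moreover have "PiE UNIV (\<lambda>_::nat. {-1..1::real}) \<inter> ?D = ?D"
    using sub by (rule inf.absorb2)
  ultimately have "compact ?D" by (simp only:)
  then show ?thesis
    unfolding unit_disc_eq_top_of_set by (intro compact_space_subtopology) simp
qed

text \<open>Shrinking along straight lines to the centre stays inside the disc.\<close>

lemma contractible_space_unit_disc: "contractible_space (unit_disc n)"
proof -
  let ?D = "{x::nat \<Rightarrow> real. (\<forall>i\<ge>n. x i = 0) \<and> (\<Sum>i<n. (x i)\<^sup>2) \<le> 1}"
  let ?h = "\<lambda>p. \<lambda>i. (1 - fst p) * (snd p i) :: real"
  have "(\<lambda>i. (1 - t) * x i) \<in> ?D" if "t \<in> {0..1}" "x \<in> ?D" for t x
  proof -
    have "(\<Sum>i<n. ((1 - t) * x i)\<^sup>2) = (1 - t)\<^sup>2 * (\<Sum>i<n. (x i)\<^sup>2)"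
      by (simp add: power_mult_distrib sum_distrib_left)
    also have "\<dots> \<le> 1 * 1"
      using that by (intro mult_mono sum_nonneg) (auto simp: power_le_one)
    finally show ?thesis using that by auto
  qed
  moreover have "continuous_on ({0..1} \<times> ?D) ?h"
  proof (rule continuous_on_coordinatewise_then_product)
    fix i
    have "continuous_on ({0..1} \<times> ?D) (\<lambda>p. snd p i)"
      by (rule continuous_on_product_then_coordinatewise[OF continuous_on_snd[OF continuous_on_id]])
    then show "continuous_on ({0..1} \<times> ?D) (\<lambda>p. (1 - fst p) * snd p i)"
      by (intro continuous_on_mult continuous_on_diff continuous_on_const continuous_on_fst continuous_on_id)
  qed
  ultimately have "homotopic_with (\<lambda>x. True) (top_of_set ?D) (top_of_set ?D) id (\<lambda>x. (\<lambda>i. 0))"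
    unfolding homotopic_with_def prod_topology_subtopology_eu
    by (intro exI[of _ ?h] conjI) (simp_all add: Pi_iff)
  then show ?thesis
    unfolding contractible_space_def unit_disc_eq_top_of_set by blast
qed

section \<open>The boundary sphere and the punctured disc\<close>

lemma unit_disc_boundary_eq:
  "unit_disc_boundary n = {x. (\<forall>i\<ge>n. x i = 0) \<and> (\<Sum>i<n. (x i)\<^sup>2) = 1}"
  by (auto simp: unit_disc_boundary_def topspace_unit_disc)

text \<open>Identifies the boundary with the library sphere, whose reduced homology is known. The
  index drops by one, as \<open>nsphere n\<close> lives in n + 1 coordinates.\<close>

lemma subtopology_unit_disc_boundary:
  "subtopology (unit_disc (Suc n)) (unit_disc_boundary (Suc n)) = nsphere n"
proof -
  have "nsphere n = top_of_set {x. (\<forall>i\<ge>Suc n. x i = 0) \<and> (\<Sum>i\<le>n. (x i)\<^sup>2) = 1}"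
    by (simp add: nsphere_def Euclidean_space_def euclidean_product_topology
        subtopology_subtopology Collect_conj_eq)
  moreover have "{x::nat \<Rightarrow> real. (\<forall>i\<ge>Suc n. x i = 0) \<and> (\<Sum>i<Suc n. (x i)\<^sup>2) \<le> 1} \<inter> unit_disc_boundary (Suc n)
      = {x. (\<forall>i\<ge>Suc n. x i = 0) \<and> (\<Sum>i\<le>n. (x i)\<^sup>2) = 1}"
    unfolding unit_disc_boundary_eq lessThan_Suc_atMost by fastforce
  ultimately show ?thesis
    by (simp only: unit_disc_eq_top_of_set subtopology_subtopology)
qed

lemma unit_disc_boundary_nonempty: "unit_disc_boundary (Suc n) \<noteq> {}"
proof -
  have "(\<lambda>i. if i = 0 then 1 else 0) \<in> unit_disc_boundary (Suc n)"
    by (simp add: unit_disc_boundary_eq if_distrib[of "\<lambda>x. x ^ 2"] cong: if_cong)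
  then show ?thesis by blast
qed

lemma zero_in_unit_disc: "(\<lambda>_. 0) \<in> topspace (unit_disc n) - unit_disc_boundary n"
  by (auto simp: topspace_unit_disc unit_disc_boundary_eq)

text \<open>The retraction is the radial projection, which divides a point by its norm and is
  continuous away from the centre.\<close>

lemma unit_disc_boundary_retract:
  "unit_disc_boundary n retract_of_space
     subtopology (unit_disc n) (topspace (unit_disc n) - {\<lambda>_. 0})"
proof -
  let ?D = "{x::nat \<Rightarrow> real. (\<forall>i\<ge>n. x i = 0) \<and> (\<Sum>i<n. (x i)\<^sup>2) \<le> 1}"
  let ?r = "\<lambda>x i. x i / sqrt (\<Sum>i<n. (x i)\<^sup>2)"
  have pos: "0 < (\<Sum>i<n. (x i)\<^sup>2)" if "x \<in> ?D - {\<lambda>_. 0}" for x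
  proof -
    have "\<exists>i. x i \<noteq> 0" using that by (auto simp: fun_eq_iff)
    then obtain i where "x i \<noteq> 0" ..
    moreover from this have "i < n" using that by (auto intro: leI)
    ultimately show ?thesis by (intro sum_pos2[of _ i]) auto
  qed
  have "continuous_on (?D - {\<lambda>_. 0}) ?r"
  proof (rule continuous_on_coordinatewise_then_product)
    have c: "continuous_on (?D - {\<lambda>_. 0}) (\<lambda>x. x i)" for i
      by (rule continuous_on_product_then_coordinatewise[OF continuous_on_id])
    have nz: "sqrt (\<Sum>i<n. (x i)\<^sup>2) \<noteq> 0" if "x \<in> ?D - {\<lambda>_. 0}" for x
      using pos[OF that] by simp
    show "continuous_on (?D - {\<lambda>_. 0}) (\<lambda>x. x i / sqrt (\<Sum>i<n. (x i)\<^sup>2))" for i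
      by (intro ballI nz continuous_on_divide continuous_on_real_sqrt continuous_on_sum continuous_on_power c) assumption
  qed
  moreover have "?r x \<in> unit_disc_boundary n" if "x \<in> ?D - {\<lambda>_. 0}" for x
  proof -
    have "(\<Sum>i<n. (?r x i)\<^sup>2) = (\<Sum>i<n. (x i)\<^sup>2) / (\<Sum>i<n. (x i)\<^sup>2)"
      using pos[OF that] by (simp only: power_divide real_sqrt_pow2[OF less_imp_le] sum_divide_distrib)
    then show ?thesis
      using that pos[OF that] by (simp add: unit_disc_boundary_eq)
  qed
  moreover have "(?D \<inter> (?D - {\<lambda>_. 0})) = ?D - {\<lambda>_. 0}" by blast
  moreover have "unit_disc_boundary n \<subseteq> ?D - {\<lambda>_. 0}"
    by (auto simp: unit_disc_boundary_eq)
  moreover have "subtopology (unit_disc n) (?D - {\<lambda>_. 0}) = top_of_set (?D - {\<lambda>_. 0})"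
    unfolding unit_disc_eq_top_of_set subtopology_subtopology by (rule arg_cong) blast
  moreover have "subtopology (top_of_set (?D - {\<lambda>_. 0})) (unit_disc_boundary n) = top_of_set (unit_disc_boundary n)"
    unfolding subtopology_subtopology using calculation(4) by (simp add: inf.absorb2)
  moreover have "?r x = x" if "x \<in> unit_disc_boundary n" for x
    using that by (simp add: unit_disc_boundary_eq)
  ultimately show ?thesis
    unfolding retract_of_space_def topspace_unit_disc
    by (intro conjI exI[of _ ?r]) (simp_all add: image_subset_iff Pi_iff)
qed

lemma Hausdorff_space_unit_disc: "Hausdorff_space (unit_disc n)"
  by (simp add: unit_disc_eq_top_of_set Hausdorff_space_subtopology)

lemma closedin_unit_disc_boundary: "closedin (unit_disc n) (unit_disc_boundary n)"
proof -
  have "closed {x::nat \<Rightarrow> real. (\<Sum>i<n. (x i)\<^sup>2) = 1}"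
    by (intro closed_Collect_eq continuous_intros) auto
  moreover have "unit_disc_boundary n = topspace (unit_disc n) \<inter> {x. (\<Sum>i<n. (x i)\<^sup>2) = 1}"
    by (auto simp: unit_disc_boundary_def)
  ultimately show ?thesis
    by (auto simp: unit_disc_eq_top_of_set closedin_closed)
qed

section \<open>Local homology at the centre of a cell\<close>

text \<open>If m were nonzero, the image of \<open>c\<close> in the integers would be a torsion
  element, hence zero. Then \<open>c\<close> would be trivial and so would the group it generates,
  unlike the integers.\<close>

lemma integer_group_generator_infinite_order:
  assumes "group G" "G \<cong> integer_group" "c \<in> carrier G" "generate G {c} = carrier G"
    and "c [^]\<^bsub>G\<^esub> (m::int) = \<one>\<^bsub>G\<^esub>"
  shows "m = 0"
proof (rule ccontr)
  assume "m \<noteq> 0"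
  interpret group G by fact
  obtain h where h: "h \<in> iso G integer_group" using assms(2) by (auto simp: is_iso_def)
  interpret gh: group_hom G integer_group h
    using h by (simp add: group_hom_def group_hom_axioms_def iso_def assms(1))
  have "h c [^]\<^bsub>integer_group\<^esub> m = 0"
    using gh.hom_int_pow[OF assms(3), of m] gh.hom_one by (simp only: assms(5)) simp
  then have "h c = 0" using \<open>m \<noteq> 0\<close> by simp
  then have "c = \<one>\<^bsub>G\<^esub>"
    using h gh.hom_one assms(3) by (auto simp: iso_def bij_betw_def inj_on_def)
  then have "carrier G = {\<one>\<^bsub>G\<^esub>}"
    using assms(4) generate_one by simp
  then have "trivial_group integer_group"
    using isomorphic_group_triviality[OF assms(2)] assms(1) by (simp add: trivial_group_def)
  then show False by (simp add: nontrivial_integer_group)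
qed

text \<open>As the disc is contractible, the connecting map identifies this group with the reduced
  homology of the boundary sphere one degree lower. For \<open>n = 0\<close> the boundary is empty
  and the disc is a point, so the coefficient group itself appears.\<close>

lemma relative_homology_group_unit_disc:
  "relative_homology_group (int n) (unit_disc n) (unit_disc_boundary n) \<cong> integer_group"
proof (cases n)
  case 0
  have "unit_disc_boundary 0 = {}" by (simp add: unit_disc_boundary_eq)
  moreover have "topspace (unit_disc 0) = {\<lambda>_. 0}" by (auto simp: topspace_unit_disc)
  ultimately show ?thesis using 0 homology_coefficients by simp
next
  case (Suc k)
  have "topspace (unit_disc n) \<inter> unit_disc_boundary n \<noteq> {}"
    using unit_disc_boundary_nonempty[of k] unfolding Suc unit_disc_boundary_def by blast
  then have "relative_homology_group (int n) (unit_disc n) (unit_disc_boundary n) \<cong>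
      reduced_homology_group (int n - 1) (subtopology (unit_disc n) (unit_disc_boundary n))"
    by (rule isomorphic_group_relative_homology_of_contractible[OF contractible_space_unit_disc])
  also have "\<dots> \<cong> integer_group"
    using reduced_homology_group_nsphere(1)[of k] by (simp add: Suc subtopology_unit_disc_boundary)
  finally show ?thesis .
qed

text \<open>First half of the passage to local homology at the centre. The connecting map of the
  disc and its sphere is injective because the disc is contractible, and the sphere, a retract of
  the punctured disc, injects in homology. By naturality their composite also factors with the
  present map applied first. For \<open>n = 0\<close> both subspaces are empty and the map is the
  identity.\<close>

lemma inj_on_hom_induced_unit_disc_puncture:
  "inj_on (hom_induced (int n) (unit_disc n) (unit_disc_boundary n)
             (unit_disc n) (topspace (unit_disc n) - {\<lambda>_. 0}) id)
     (carrier (relative_homology_group (int n) (unit_disc n) (unit_disc_boundary n)))"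
proof (cases n)
  case 0
  have "unit_disc_boundary 0 = {}" by (simp add: unit_disc_boundary_eq)
  moreover have "topspace (unit_disc 0) = {\<lambda>_. 0}" by (auto simp: topspace_unit_disc)
  ultimately show ?thesis using 0 by (auto simp: inj_on_def hom_induced_id)
next
  case (Suc k)
  let ?D = "unit_disc n" let ?B = "unit_disc_boundary n" let ?P = "topspace ?D - {\<lambda>_. 0}"
  have BP: "?B \<subseteq> ?P" using zero_in_unit_disc[of n] by (auto simp: unit_disc_boundary_def)
  have "?B \<noteq> {}" "topspace ?D \<inter> ?B = ?B"
    using unit_disc_boundary_nonempty[of k] unfolding Suc unit_disc_boundary_def by auto
  then have 1: "inj_on (hom_boundary (int n) ?D ?B) (carrier (relative_homology_group (int n) ?D ?B))"
    using iso_relative_homology_of_contractible[OF contractible_space_unit_disc, of n ?B "int n"]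
    by (auto simp: iso_def bij_betw_def)
  have s: "subtopology (subtopology ?D ?P) ?B = subtopology ?D ?B"
    using BP by (simp add: subtopology_subtopology inf.absorb2)
  have 2: "inj_on (hom_induced (int n - 1) (subtopology ?D ?B) {} (subtopology ?D ?P) {} id)
      (carrier (homology_group (int n - 1) (subtopology ?D ?B)))"
    using inj_on_hom_induced_inclusion[of ?B "subtopology ?D ?P" "int n - 1"]
      unit_disc_boundary_retract[of n] by (simp add: s)
  have 3: "hom_boundary (int n) ?D ?P \<circ> hom_induced (int n) ?D ?B ?D ?P id
       = hom_induced (int n - 1) (subtopology ?D ?B) {} (subtopology ?D ?P) {} id \<circ> hom_boundary (int n) ?D ?B"
    using BP by (intro naturality_hom_induced) auto
  have "inj_on (hom_boundary (int n) ?D ?P \<circ> hom_induced (int n) ?D ?B ?D ?P id)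
      (carrier (relative_homology_group (int n) ?D ?B))"
    unfolding 3 by (rule comp_inj_on[OF 1 inj_on_subset[OF 2]]) (auto simp: hom_boundary_carrier)
  then show ?thesis by (rule inj_on_imageI2)
qed

text \<open>Two kinds of points avoid \<phi> z: those of \<open>B\<close> are sent outside \<rho>,
  which contains \<phi> z, and those off \<open>B\<close> are separated from z by
  injectivity.\<close>

lemma punctured_funcset:
  assumes z: "z \<in> topspace D - B"
    and \<phi>: "continuous_map D X \<phi>" "\<phi> \<in> B \<rightarrow> topspace X - \<rho>"
    and inj: "inj_on \<phi> (topspace D - B)" and im: "\<phi> ` (topspace D - B) = \<rho>"
  shows "\<phi> \<in> topspace D - {z} \<rightarrow> topspace X - {\<phi> z}"
proof
  fix x assume x: "x \<in> topspace D - {z}"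
  have "\<phi> x \<in> topspace X" using x \<phi>(1) by (auto simp: continuous_map_def)
  moreover have "\<phi> x \<noteq> \<phi> z"
  proof (cases "x \<in> B")
    case True then show ?thesis using \<phi>(2) z im by (metis DiffE Pi_mem imageI)
  next
    case False then show ?thesis using inj x z by (auto simp: inj_on_def)
  qed
  ultimately show "\<phi> x \<in> topspace X - {\<phi> z}" by blast
qed

text \<open>Second half of the passage to local homology. Excision shrinks both pairs to the open
  parts \<open>topspace D - B\<close> and \<rho>, between which \<phi> is a homeomorphism.\<close>

lemma inj_on_hom_induced_local:
  assumes B: "closedin D B" and z: "z \<in> topspace D - B"
    and Dz: "openin D (topspace D - {z})" and Xz: "openin X (topspace X - {\<phi> z})"
    and \<rho>: "openin X \<rho>" and \<phi>: "continuous_map D X \<phi>" "\<phi> \<in> B \<rightarrow> topspace X - \<rho>"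
    and h: "homeomorphic_map (subtopology D (topspace D - B)) (subtopology X \<rho>) \<phi>"
  shows "inj_on (hom_induced p D (topspace D - {z}) X (topspace X - {\<phi> z}) \<phi>)
           (carrier (relative_homology_group p D (topspace D - {z})))"
proof -
  let ?E = "topspace D - B" let ?Dz = "topspace D - {z}" let ?Xz = "topspace X - {\<phi> z}"
  have BD: "B \<subseteq> topspace D" using B closedin_subset by blast
  have \<rho>X: "\<rho> \<subseteq> topspace X" using \<rho> openin_subset by blast
  have im: "\<phi> ` ?E = \<rho>" and inj: "inj_on \<phi> ?E"
    using h \<rho>X Int_absorb1[of ?E "topspace D"]
    by (auto simp: homeomorphic_eq_everything_map)
  have \<phi>z: "\<phi> z \<in> \<rho>" using im z by blast
  have fD: "\<phi> \<in> ?Dz \<rightarrow> ?Xz"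
    by (rule punctured_funcset[OF z \<phi> inj im])
  \<comment> \<open>The set \<open>B\<close> can be excised, being closed and contained in the open
    complement of z.\<close>
  have exD: "hom_induced p (subtopology D ?E) (?E - {z}) D ?Dz id
      \<in> iso (relative_homology_group p (subtopology D ?E) (?E - {z})) (relative_homology_group p D ?Dz)"
  proof -
    have "D closure_of B \<subseteq> D interior_of ?Dz"
      using B Dz z BD by (simp add: closure_of_closedin interior_of_openin) blast
    moreover have "?Dz - B = ?E - {z}" by blast
    ultimately show ?thesis
      using homology_excision_axiom[of D B ?Dz "topspace D" p] by simp
  qed
  \<comment> \<open>In the target the excised set is the closed complement of \<rho>.\<close>
  have exX: "hom_induced p (subtopology X \<rho>) (\<rho> - {\<phi> z}) X ?Xz id
      \<in> iso (relative_homology_group p (subtopology X \<rho>) (\<rho> - {\<phi> z})) (relative_homology_group p X ?Xz)"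
  proof -
    have "closedin X (topspace X - \<rho>)" using \<rho> by blast
    then have "X closure_of (topspace X - \<rho>) \<subseteq> X interior_of ?Xz"
      using Xz \<phi>z by (simp add: closure_of_closedin interior_of_openin) blast
    moreover have "topspace X - (topspace X - \<rho>) = \<rho>" "?Xz - (topspace X - \<rho>) = \<rho> - {\<phi> z}"
      using \<rho>X by auto
    ultimately show ?thesis
      using homology_excision_axiom[of X "topspace X - \<rho>" ?Xz "topspace X" p] by simp
  qed
  have hE: "hom_induced p (subtopology D ?E) (?E - {z}) (subtopology X \<rho>) (\<rho> - {\<phi> z}) \<phi>
      \<in> iso (relative_homology_group p (subtopology D ?E) (?E - {z}))
            (relative_homology_group p (subtopology X \<rho>) (\<rho> - {\<phi> z}))"
  proof (rule homeomorphic_map_relative_homology_iso[OF h])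
    show "\<phi> ` (?E - {z}) = \<rho> - {\<phi> z}"
      using im inj z by (auto simp: inj_on_def)
  qed auto
  have cE: "continuous_map (subtopology D ?E) (subtopology X \<rho>) \<phi>"
    using h by (rule homeomorphic_imp_continuous_map)
  \<comment> \<open>The square formed by the two excision maps and the two maps induced by \<phi>
    commutes, since both paths are induced by \<phi> restricted to the open part.\<close>
  have "hom_induced p D ?Dz X ?Xz \<phi> \<circ> hom_induced p (subtopology D ?E) (?E - {z}) D ?Dz id
      = hom_induced p (subtopology D ?E) (?E - {z}) X ?Xz (\<phi> \<circ> id)"
    using \<phi>(1) fD by (intro hom_induced_compose[symmetric]) auto
  also have "\<dots> = hom_induced p (subtopology D ?E) (?E - {z}) X ?Xz (id \<circ> \<phi>)" by simp
  also have "\<dots> = hom_induced p (subtopology X \<rho>) (\<rho> - {\<phi> z}) X ?Xz id \<circ>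
      hom_induced p (subtopology D ?E) (?E - {z}) (subtopology X \<rho>) (\<rho> - {\<phi> z}) \<phi>"
    using cE \<rho>X im inj z by (intro hom_induced_compose) (auto simp: inj_on_def)
  finally have eq: "hom_induced p D ?Dz X ?Xz \<phi> \<circ> hom_induced p (subtopology D ?E) (?E - {z}) D ?Dz id
      = hom_induced p (subtopology X \<rho>) (\<rho> - {\<phi> z}) X ?Xz id \<circ>
      hom_induced p (subtopology D ?E) (?E - {z}) (subtopology X \<rho>) (\<rho> - {\<phi> z}) \<phi>" .
  have "inj_on (hom_induced p D ?Dz X ?Xz \<phi> \<circ> hom_induced p (subtopology D ?E) (?E - {z}) D ?Dz id)
      (carrier (relative_homology_group p (subtopology D ?E) (?E - {z})))"
    unfolding eq using hE exX by (intro comp_inj_on) (auto simp: iso_def bij_betw_def)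
  then have "inj_on (hom_induced p D ?Dz X ?Xz \<phi>)
      (hom_induced p (subtopology D ?E) (?E - {z}) D ?Dz id `
        carrier (relative_homology_group p (subtopology D ?E) (?E - {z})))"
    by (rule inj_on_imageI)
  then show ?thesis using exD by (simp add: iso_def bij_betw_def)
qed

section \<open>The cellular boundary squares to zero\<close>

lemma hom_finprod:
  assumes "comm_group G" "comm_group H" "h \<in> hom G H" "f \<in> A \<rightarrow> carrier G" "finite A"
  shows "h (finprod G f A) = finprod H (\<lambda>x. h (f x)) A"
proof -
  interpret G: comm_group G by fact
  interpret H: comm_group H by fact
  interpret group_hom G H h
    using assms by (simp add: group_hom_def group_hom_axioms_def G.is_group H.is_group)
  show ?thesis using assms(5,4)
  proof induction
    case (insert x A)
    then have "f x \<in> carrier G" "f \<in> A \<rightarrow> carrier G" by auto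
    moreover have "(\<lambda>x. h (f x)) \<in> A \<rightarrow> carrier H"
    proof
      fix y assume "y \<in> A"
      then have "f y \<in> carrier G" using insert.prems by auto
      then show "h (f y) \<in> carrier H" by (rule hom_closed)
    qed
    ultimately show ?case
      using insert.hyps insert.IH by (simp add: G.finprod_insert H.finprod_insert hom_closed hom_mult)
  qed simp
qed

lemma finprod_eq_single:
  assumes "comm_monoid G" "finite A" "a \<in> A" "f a \<in> carrier G"
    and "\<And>x. x \<in> A \<Longrightarrow> x \<noteq> a \<Longrightarrow> f x = \<one>\<^bsub>G\<^esub>"
  shows "finprod G f A = f a"
proof -
  interpret comm_monoid G by fact
  have "f \<in> A - {a} \<rightarrow> carrier G" using assms by auto
  moreover have "finprod G f (A - {a}) = \<one>\<^bsub>G\<^esub>"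
    using assms(5) by (intro finprod_one_eqI) auto
  ultimately show ?thesis
    using finprod_insert[of "A - {a}" a f] assms by (simp add: insert_absorb)
qed

lemma finprod_int_pow:
  assumes "comm_group G" "finite A" "f \<in> A \<rightarrow> carrier G"
  shows "finprod G (\<lambda>x. f x [^]\<^bsub>G\<^esub> (k::int)) A = finprod G f A [^]\<^bsub>G\<^esub> k"
proof -
  interpret comm_group G by fact
  show ?thesis using assms(2,3)
  proof induction
    case (insert x A)
    then have "f x \<in> carrier G" "f \<in> A \<rightarrow> carrier G" by auto
    moreover from this have "(\<lambda>x. f x [^]\<^bsub>G\<^esub> k) \<in> A \<rightarrow> carrier G" by auto
    ultimately show ?case using insert by (simp add: int_pow_distrib)
  qed simp
qed

lemma finprod_int_pow_sum:
  assumes "comm_group G" "finite A" "c \<in> carrier G"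
  shows "finprod G (\<lambda>x. c [^]\<^bsub>G\<^esub> (k x::int)) A = c [^]\<^bsub>G\<^esub> (\<Sum>x\<in>A. k x)"
proof -
  interpret comm_group G by fact
  show ?thesis using assms(2)
    by induction (use assms(3) in \<open>auto simp: int_pow_mult\<close>)
qed

lemma finprod_swap:
  assumes "comm_group G" "finite A" "finite B" "\<And>x y. x \<in> A \<Longrightarrow> y \<in> B \<Longrightarrow> f x y \<in> carrier G"
  shows "finprod G (\<lambda>x. finprod G (f x) B) A = finprod G (\<lambda>y. finprod G (\<lambda>x. f x y) A) B"
proof -
  interpret comm_group G by fact
  show ?thesis using assms(2,4)
  proof induction
    case (insert x A)
    then have "(\<lambda>x. finprod G (f x) B) \<in> insert x A \<rightarrow> carrier G" by auto
    then have "finprod G (\<lambda>x. finprod G (f x) B) (insert x A)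
        = finprod G (f x) B \<otimes>\<^bsub>G\<^esub> finprod G (\<lambda>y. finprod G (\<lambda>x. f x y) A) B"
      using insert by simp
    also have "\<dots> = finprod G (\<lambda>y. f x y \<otimes>\<^bsub>G\<^esub> finprod G (\<lambda>x. f x y) A) B"
      using insert.prems by (intro finprod_multf[symmetric]) auto
    also have "\<dots> = finprod G (\<lambda>y. finprod G (\<lambda>x. f x y) (insert x A)) B"
      using insert by (intro finprod_cong') auto
    finally show ?case .
  qed simp
qed

context
  fixes K :: "'a cw_complex"
  assumes K: "finite_cw_complex K"
begin

section \<open>Cells, skeleta and characteristic maps\<close>

lemma finite_cw_cells: "finite (cw_cells K)"
  using K by (simp add: finite_cw_complex_def)

lemma cell_subset_topspace: "\<sigma> \<in> cw_cells K \<Longrightarrow> \<sigma> \<subseteq> topspace (cw_space K)"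
  using K by (auto simp: finite_cw_complex_def)

lemma cells_disjoint: "\<sigma> \<in> cw_cells K \<Longrightarrow> \<tau> \<in> cw_cells K \<Longrightarrow> \<sigma> \<noteq> \<tau> \<Longrightarrow> \<sigma> \<inter> \<tau> = {}"
  using K by (auto simp: finite_cw_complex_def pairwise_def disjnt_def)

lemma skeleton_subset_topspace: "skeleton K n \<subseteq> topspace (cw_space K)"
  using cell_subset_topspace by (auto simp: skeleton_def)

lemma topspace_skeleton: "topspace (subtopology (cw_space K) (skeleton K n)) = skeleton K n"
  by (rule topspace_subtopology_subset[OF skeleton_subset_topspace])

lemma skeleton_mono: "m \<le> n \<Longrightarrow> skeleton K m \<subseteq> skeleton K n"
  by (auto simp: skeleton_def)

lemma cell_subset_skeleton: "\<sigma> \<in> cw_cells K \<Longrightarrow> int (cw_dim K \<sigma>) \<le> n \<Longrightarrow> \<sigma> \<subseteq> skeleton K n"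
  by (auto simp: skeleton_def)

lemma cell_skeleton_disjoint:
  "\<sigma> \<in> cw_cells K \<Longrightarrow> n < int (cw_dim K \<sigma>) \<Longrightarrow> \<sigma> \<inter> skeleton K n = {}"
  using cells_disjoint by (fastforce simp: skeleton_def)

context
  fixes \<sigma> assumes \<sigma>: "\<sigma> \<in> cw_cells K"
begin

lemma cw_map_continuous: "continuous_map (unit_disc (cw_dim K \<sigma>)) (cw_space K) (cw_map K \<sigma>)"
  using K \<sigma> by (simp add: finite_cw_complex_def)

lemma cw_map_homeomorphic:
  "homeomorphic_map
     (subtopology (unit_disc (cw_dim K \<sigma>))
        (topspace (unit_disc (cw_dim K \<sigma>)) - unit_disc_boundary (cw_dim K \<sigma>)))
     (subtopology (cw_space K) \<sigma>) (cw_map K \<sigma>)"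
  using K \<sigma> by (simp add: finite_cw_complex_def)

lemma cw_map_boundary:
  "cw_map K \<sigma> ` unit_disc_boundary (cw_dim K \<sigma>) \<subseteq> skeleton K (int (cw_dim K \<sigma>) - 1)"
  using K \<sigma> by (simp add: finite_cw_complex_def)

lemma cw_map_interior:
  "cw_map K \<sigma> ` (topspace (unit_disc (cw_dim K \<sigma>)) - unit_disc_boundary (cw_dim K \<sigma>)) = \<sigma>"
  using homeomorphic_imp_surjective_map[OF cw_map_homeomorphic] cell_subset_topspace[OF \<sigma>]
  by (simp add: Int_absorb1 Diff_subset inf.absorb2)

lemma cw_map_image_subset:
  "cw_map K \<sigma> ` topspace (unit_disc (cw_dim K \<sigma>)) \<subseteq> \<sigma> \<union> skeleton K (int (cw_dim K \<sigma>) - 1)"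
  using cw_map_interior cw_map_boundary by blast

lemma cw_map_image_skeleton:
  "cw_map K \<sigma> ` topspace (unit_disc (cw_dim K \<sigma>)) \<subseteq> skeleton K (int (cw_dim K \<sigma>))"
  using cw_map_image_subset cell_subset_skeleton[OF \<sigma>, of "int (cw_dim K \<sigma>)"]
    skeleton_mono[of "int (cw_dim K \<sigma>) - 1" "int (cw_dim K \<sigma>)"] by fastforce

lemma cw_map_continuous_skeleton:
  "continuous_map (unit_disc (cw_dim K \<sigma>))
     (subtopology (cw_space K) (skeleton K (int (cw_dim K \<sigma>)))) (cw_map K \<sigma>)"
  using cw_map_continuous cw_map_image_skeleton by (auto simp: continuous_map_in_subtopology)

text \<open>The image of the compact disc in a Hausdorff space is compact, hence closed.\<close>

lemma closedin_cw_map_image: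
  "closedin (cw_space K) (cw_map K \<sigma> ` topspace (unit_disc (cw_dim K \<sigma>)))"
proof (rule compactin_imp_closedin)
  show "Hausdorff_space (cw_space K)" using K by (simp add: finite_cw_complex_def)
  show "compactin (cw_space K) (cw_map K \<sigma> ` topspace (unit_disc (cw_dim K \<sigma>)))"
    using compact_space_unit_disc cw_map_continuous
    by (auto simp: compact_space_def intro: image_compactin)
qed

lemma cell_class_carrier:
  "cell_class K \<sigma> \<in> carrier (cellular_group K (int (cw_dim K \<sigma>)))"
  by (simp add: cell_class_def cellular_group_def hom_induced_carrier)

end

text \<open>The rest of the skeleton is a finite union of closed sets: for every other cell of at
  most this dimension, the image of its disc misses \<sigma>, because the boundary of that disc goes
  to a skeleton of smaller index than the dimension of \<sigma>.\<close>

lemma openin_skeleton_cell: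
  assumes \<sigma>: "\<sigma> \<in> cw_cells K"
  shows "openin (subtopology (cw_space K) (skeleton K (int (cw_dim K \<sigma>)))) \<sigma>"
proof -
  let ?n = "int (cw_dim K \<sigma>)"
  let ?C = "{\<tau> \<in> cw_cells K. int (cw_dim K \<tau>) \<le> ?n \<and> \<tau> \<noteq> \<sigma>}"
  let ?F = "\<lambda>\<tau>. cw_map K \<tau> ` topspace (unit_disc (cw_dim K \<tau>))"
  have F: "\<tau> \<subseteq> ?F \<tau>" "?F \<tau> \<inter> \<sigma> = {}" "?F \<tau> \<subseteq> skeleton K ?n" if "\<tau> \<in> ?C" for \<tau>
  proof -
    have \<tau>: "\<tau> \<in> cw_cells K" "int (cw_dim K \<tau>) \<le> ?n" "\<tau> \<noteq> \<sigma>" using that by auto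
    show "\<tau> \<subseteq> ?F \<tau>" using cw_map_interior[OF \<tau>(1)] by blast
    have "\<sigma> \<inter> skeleton K (int (cw_dim K \<tau>) - 1) = {}"
      using \<tau>(2) by (intro cell_skeleton_disjoint[OF \<sigma>]) simp
    then show "?F \<tau> \<inter> \<sigma> = {}"
      using cw_map_image_subset[OF \<tau>(1)] cells_disjoint[OF \<tau>(1) \<sigma> \<tau>(3)] by blast
    show "?F \<tau> \<subseteq> skeleton K ?n"
      using cw_map_image_skeleton[OF \<tau>(1)] skeleton_mono[OF \<tau>(2)] by blast
  qed
  have "closedin (cw_space K) (\<Union>\<tau>\<in>?C. ?F \<tau>)"
    using finite_cw_cells closedin_cw_map_image by (intro closedin_Union) auto
  then have "closedin (subtopology (cw_space K) (skeleton K ?n)) (\<Union>\<tau>\<in>?C. ?F \<tau>)"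
    using F(3) by (intro closedin_subset_topspace) auto
  moreover have "skeleton K ?n - (\<Union>\<tau>\<in>?C. ?F \<tau>) = \<sigma>"
  proof
    show "skeleton K ?n - (\<Union>\<tau>\<in>?C. ?F \<tau>) \<subseteq> \<sigma>"
    proof
      fix x assume x: "x \<in> skeleton K ?n - (\<Union>\<tau>\<in>?C. ?F \<tau>)"
      then obtain \<tau> where "\<tau> \<in> cw_cells K" "int (cw_dim K \<tau>) \<le> ?n" "x \<in> \<tau>"
        unfolding skeleton_def by blast
      then show "x \<in> \<sigma>" using F(1)[of \<tau>] x by blast
    qed
    show "\<sigma> \<subseteq> skeleton K ?n - (\<Union>\<tau>\<in>?C. ?F \<tau>)"
      using F(2) cell_subset_skeleton[OF \<sigma>, of ?n] by blast
  qed
  ultimately show ?thesis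
    using openin_diff[OF openin_topspace, of "subtopology (cw_space K) (skeleton K ?n)" "\<Union>\<tau>\<in>?C. ?F \<tau>"]
    unfolding topspace_skeleton by (simp only:)
qed

text \<open>Passing to the pair \<open>(X, X - {x})\<close>, with \<open>X\<close> the skeleton and \<open>x\<close> the centre of one cell,
  kills the classes of all other cells of the same dimension and is injective on the multiples
  of the class of that cell.\<close>

lemma cell_class_detect:
  assumes "oriented_cells K" and \<sigma>: "\<sigma> \<in> cw_cells K"
  obtains H :: "'a chain set monoid" and h
  where "comm_group H" "h \<in> hom (cellular_group K (int (cw_dim K \<sigma>))) H"
    "\<And>m::int. h (cell_class K \<sigma>) [^]\<^bsub>H\<^esub> m = \<one>\<^bsub>H\<^esub> \<Longrightarrow> m = 0"
    "\<And>\<tau>. \<tau> \<in> cw_cells K \<Longrightarrow> cw_dim K \<tau> = cw_dim K \<sigma> \<Longrightarrow> \<tau> \<noteq> \<sigma> \<Longrightarrow> h (cell_class K \<tau>) = \<one>\<^bsub>H\<^esub>"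
proof -
  define n where "n = cw_dim K \<sigma>"
  define X where "X = subtopology (cw_space K) (skeleton K (int n))"
  define A where "A = skeleton K (int n - 1)"
  let ?D = "unit_disc n" let ?B = "unit_disc_boundary n" let ?\<phi> = "cw_map K \<sigma>"
  define x where "x = ?\<phi> (\<lambda>_. 0)"
  define P where "P = topspace X - {x}"
  let ?Dz = "topspace ?D - {\<lambda>_. 0}"
  let ?G = "relative_homology_group (int n) ?D ?B"
  let ?H = "relative_homology_group (int n) X P"
  define h where "h = hom_induced (int n) X A X P id"
  have tX: "topspace X = skeleton K (int n)" unfolding X_def by (rule topspace_skeleton)
  have x\<sigma>: "x \<in> \<sigma>"
    using cw_map_interior[OF \<sigma>] zero_in_unit_disc[of n] unfolding x_def n_def by blast
  have AP: "A \<subseteq> P"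
    using skeleton_mono[of "int n - 1" "int n"] cell_skeleton_disjoint[OF \<sigma>, of "int n - 1"] x\<sigma>
    unfolding A_def P_def tX n_def by auto
  have G: "cellular_group K (int n) = relative_homology_group (int n) X A"
    by (simp add: cellular_group_def X_def A_def)
  have cls: "cell_class K \<tau> = hom_induced (int n) ?D ?B X A (cw_map K \<tau>) (cw_orient K \<tau>)"
    "continuous_map ?D X (cw_map K \<tau>)" "cw_map K \<tau> \<in> ?B \<rightarrow> A"
    if "\<tau> \<in> cw_cells K" "cw_dim K \<tau> = n" for \<tau>
    using that cw_map_continuous_skeleton[OF that(1)] cw_map_boundary[OF that(1)]
    by (auto simp: cell_class_def X_def A_def)
  have hcls: "h (cell_class K \<tau>) = hom_induced (int n) ?D ?B X P (cw_map K \<tau>) (cw_orient K \<tau>)"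
    if "\<tau> \<in> cw_cells K" "cw_dim K \<tau> = n" for \<tau>
    unfolding h_def cls(1)[OF that] using cls(2,3)[OF that] AP
    by (subst hom_induced_compose') auto
  have hG: "h \<in> hom (relative_homology_group (int n) X A) ?H"
    unfolding h_def by (rule hom_induced_hom)
  \<comment> \<open>The image of another \<open>n\<close>-cell misses the centre \<open>x\<close>,
    so its class factors through the pair \<open>(P, P)\<close>, whose relative homology is
    trivial.\<close>
  have kill: "h (cell_class K \<tau>) = \<one>\<^bsub>?H\<^esub>" if \<tau>: "\<tau> \<in> cw_cells K" "cw_dim K \<tau> = n" "\<tau> \<noteq> \<sigma>" for \<tau>
  proof -
    let ?Y = "subtopology X P" let ?g = "cw_map K \<tau>"
    have "x \<notin> ?g ` topspace ?D"
      using cw_map_image_subset[OF \<tau>(1)] cells_disjoint[OF \<tau>(1) \<sigma> \<tau>(3)] x\<sigma>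
        cell_skeleton_disjoint[OF \<sigma>, of "int n - 1"] \<tau>(2) unfolding n_def by fastforce
    then have c: "continuous_map ?D ?Y ?g"
      using cls(2)[OF \<tau>(1,2)] continuous_map_image_subset_topspace[OF cls(2)[OF \<tau>(1,2)]]
      by (auto simp: continuous_map_in_subtopology P_def)
    have tY: "topspace ?Y = P" by (auto simp: P_def)
    have gB: "?g \<in> ?B \<rightarrow> P" using cls(3)[OF \<tau>(1,2)] AP by auto
    have "hom_induced (int n) ?D ?B X P (id \<circ> ?g) (cw_orient K \<tau>)
        = hom_induced (int n) ?Y P X P id (hom_induced (int n) ?D ?B ?Y P ?g (cw_orient K \<tau>))"
      using c gB by (subst hom_induced_compose') auto
    also have "hom_induced (int n) ?D ?B ?Y P ?g (cw_orient K \<tau>) = \<one>\<^bsub>relative_homology_group (int n) ?Y P\<^esub>"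
      using trivial_relative_homology_group_topspace[of "int n" ?Y]
        hom_induced_carrier[of "int n" ?D ?B ?Y P ?g "cw_orient K \<tau>"]
      unfolding tY trivial_group_def by auto
    also have "hom_induced (int n) ?Y P X P id \<dots> = \<one>\<^bsub>?H\<^esub>"
      by (rule hom_one[OF hom_induced_hom]) auto
    finally show ?thesis by (simp add: hcls[OF \<tau>(1,2)])
  qed
  have or: "cw_orient K \<sigma> \<in> carrier ?G" "generate ?G {cw_orient K \<sigma>} = carrier ?G"
    using assms by (auto simp: oriented_cells_def Let_def n_def)
  \<comment> \<open>On the class of \<sigma> itself \<open>h\<close> is computed in two stages:
    enlarge the sphere to the punctured disc, then push forward along the characteristic map. Each
    stage is injective.\<close>
  let ?k = "hom_induced (int n) ?D ?B ?D ?Dz id"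
  let ?g = "hom_induced (int n) ?D ?Dz X P ?\<phi>"
  have opX: "openin X P" "openin X \<sigma>" and opD: "openin ?D ?Dz" and cB: "closedin ?D ?B"
  proof -
    have "Hausdorff_space X"
      using K by (simp add: X_def finite_cw_complex_def Hausdorff_space_subtopology)
    moreover have "x \<in> topspace X"
      using cell_subset_skeleton[OF \<sigma>, of "int n"] x\<sigma> unfolding tX n_def by auto
    ultimately show "openin X P"
      unfolding P_def by (intro openin_diff openin_topspace closedin_Hausdorff_singleton)
    show "openin X \<sigma>" using openin_skeleton_cell[OF \<sigma>] by (simp add: X_def n_def)
    show "openin ?D ?Dz"
      using zero_in_unit_disc[of n]
      by (intro openin_diff openin_topspace closedin_Hausdorff_singleton Hausdorff_space_unit_disc) auto
    show "closedin ?D ?B" by (rule closedin_unit_disc_boundary)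
  qed
  have \<phi>B: "?\<phi> \<in> ?B \<rightarrow> topspace X - \<sigma>"
  proof -
    have "A \<subseteq> topspace X - \<sigma>"
      using skeleton_mono[of "int n - 1" "int n"] cell_skeleton_disjoint[OF \<sigma>, of "int n - 1"]
      unfolding A_def tX n_def by auto
    then show ?thesis using cls(3)[OF \<sigma>] n_def by auto
  qed
  have c\<phi>: "continuous_map ?D X ?\<phi>" using cls(2)[OF \<sigma>] n_def by simp
  have hm: "homeomorphic_map (subtopology ?D (topspace ?D - ?B)) (subtopology X \<sigma>) ?\<phi>"
  proof -
    have "subtopology X \<sigma> = subtopology (cw_space K) \<sigma>"
      using cell_subset_skeleton[OF \<sigma>, of "int n"]
      by (simp add: X_def n_def subtopology_subtopology inf.absorb2)
    then show ?thesis using cw_map_homeomorphic[OF \<sigma>] by (simp add: n_def)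
  qed
  have injg: "inj_on ?g (carrier (relative_homology_group (int n) ?D ?Dz))"
    using inj_on_hom_induced_local[of ?D ?B "\<lambda>_. 0" X ?\<phi> \<sigma> "int n"] zero_in_unit_disc[of n]
      opD opX cB c\<phi> \<phi>B hm by (simp add: P_def x_def)
  have "?\<phi> \<in> ?Dz \<rightarrow> P"
    unfolding P_def x_def
  proof (rule punctured_funcset[OF zero_in_unit_disc c\<phi> \<phi>B])
    show "inj_on ?\<phi> (topspace ?D - ?B)"
      using homeomorphic_imp_injective_map[OF hm] by (simp add: inf.absorb2 Diff_subset)
    show "?\<phi> ` (topspace ?D - ?B) = \<sigma>" using cw_map_interior[OF \<sigma>] n_def by simp
  qed
  moreover have "?B \<subseteq> ?Dz" using zero_in_unit_disc[of n] by (auto simp: unit_disc_boundary_def)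
  ultimately have gk: "h (cell_class K \<sigma>) = (?g \<circ> ?k) (cw_orient K \<sigma>)"
    unfolding hcls[OF \<sigma> n_def[symmetric]] o_apply using c\<phi>
    by (subst hom_induced_compose') auto
  have inj: "inj_on (?g \<circ> ?k) (carrier ?G)"
    by (intro comp_inj_on inj_on_hom_induced_unit_disc_puncture inj_on_subset[OF injg])
      (auto simp: hom_induced_carrier)
  have hom: "?g \<circ> ?k \<in> hom ?G ?H"
    by (intro hom_compose[OF hom_induced_hom hom_induced_hom])
  \<comment> \<open>The orientation generates a copy of the integers on which
    \<open>?g \<circ> ?k\<close> is injective, so no nonzero power of its image is trivial.\<close>
  have inf: "m = 0" if "h (cell_class K \<sigma>) [^]\<^bsub>?H\<^esub> m = \<one>\<^bsub>?H\<^esub>" for m :: int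
  proof -
    interpret group_hom ?G ?H "?g \<circ> ?k"
      using hom by (simp add: group_hom_def group_hom_axioms_def)
    have "(?g \<circ> ?k) (cw_orient K \<sigma> [^]\<^bsub>?G\<^esub> m) = (?g \<circ> ?k) \<one>\<^bsub>?G\<^esub>"
      using that gk hom_int_pow[OF or(1), of m] hom_one by (simp only:)
    then have "cw_orient K \<sigma> [^]\<^bsub>?G\<^esub> m = \<one>\<^bsub>?G\<^esub>"
      by (rule inj_onD[OF inj]) (rule G.int_pow_closed[OF or(1)], rule G.one_closed)
    then show ?thesis
      by (intro integer_group_generator_infinite_order[OF _ relative_homology_group_unit_disc or]) auto
  qed
  show thesis
    using that[of ?H h] hG kill inf by (simp add: G n_def[symmetric])
qed

text \<open>The detecting homomorphism of \<rho>, applied to the relation, leaves only the factor of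
  \<rho> and thereby forces its exponent to be zero.\<close>

lemma cell_classes_independent:
  fixes m :: "'a set \<Rightarrow> int"
  assumes or: "oriented_cells K" and \<rho>: "\<rho> \<in> cw_cells K" "int (cw_dim K \<rho>) = n"
    and eq: "finprod (cellular_group K n) (\<lambda>\<tau>. cell_class K \<tau> [^]\<^bsub>cellular_group K n\<^esub> m \<tau>)
              {\<tau> \<in> cw_cells K. int (cw_dim K \<tau>) = n} = \<one>\<^bsub>cellular_group K n\<^esub>"
  shows "m \<rho> = 0"
proof -
  let ?G = "cellular_group K n" let ?C = "{\<tau> \<in> cw_cells K. int (cw_dim K \<tau>) = n}"
  obtain H :: "'a chain set monoid" and h where H: "comm_group H" "h \<in> hom ?G H"
    and inf: "\<And>m::int. h (cell_class K \<rho>) [^]\<^bsub>H\<^esub> m = \<one>\<^bsub>H\<^esub> \<Longrightarrow> m = 0"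
    and kill: "\<And>\<tau>. \<tau> \<in> cw_cells K \<Longrightarrow> cw_dim K \<tau> = cw_dim K \<rho> \<Longrightarrow> \<tau> \<noteq> \<rho> \<Longrightarrow> h (cell_class K \<tau>) = \<one>\<^bsub>H\<^esub>"
    using cell_class_detect[OF or \<rho>(1)] \<rho>(2) by metis
  have G: "comm_group ?G" by (simp add: cellular_group_def)
  interpret G: comm_group ?G by fact
  interpret H: comm_group H by fact
  interpret group_hom ?G H h
    using H by (simp add: group_hom_def group_hom_axioms_def G.is_group H.is_group)
  have c: "cell_class K \<tau> \<in> carrier ?G" if "\<tau> \<in> ?C" for \<tau>
    using cell_class_carrier[of \<tau>] that by auto
  have "\<one>\<^bsub>H\<^esub> = h (finprod ?G (\<lambda>\<tau>. cell_class K \<tau> [^]\<^bsub>?G\<^esub> m \<tau>) ?C)"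
    by (simp add: eq)
  also have "\<dots> = finprod H (\<lambda>\<tau>. h (cell_class K \<tau> [^]\<^bsub>?G\<^esub> m \<tau>)) ?C"
    using c finite_cw_cells by (intro hom_finprod G H) auto
  also have "\<dots> = h (cell_class K \<rho> [^]\<^bsub>?G\<^esub> m \<rho>)"
  proof (rule finprod_eq_single)
    show "h (cell_class K \<tau> [^]\<^bsub>?G\<^esub> m \<tau>) = \<one>\<^bsub>H\<^esub>" if "\<tau> \<in> ?C" "\<tau> \<noteq> \<rho>" for \<tau>
      using that kill[of \<tau>] \<rho>(2) hom_int_pow[OF c[OF that(1)], of "m \<tau>"] by simp
  qed (use finite_cw_cells \<rho> c H.comm_monoid_axioms in auto)
  also have "\<dots> = h (cell_class K \<rho>) [^]\<^bsub>H\<^esub> m \<rho>"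
    using c \<rho> by (intro hom_int_pow) auto
  finally show ?thesis by (metis inf)
qed

text \<open>The composite contains two consecutive maps of the exact sequence for the skeleta of
  index \<open>n - 1\<close> and \<open>n - 2\<close>: from absolute to relative homology, then the
  connecting map.\<close>

lemma cellular_boundary_map_squared:
  "cellular_boundary_map K (n - 1) (cellular_boundary_map K n c) = \<one>\<^bsub>cellular_group K (n - 2)\<^esub>"
proof -
  let ?X = "\<lambda>m. subtopology (cw_space K) (skeleton K m)"
  have s: "subtopology (?X m) (skeleton K (m - 1)) = ?X (m - 1)" for m
    using skeleton_mono[of "m - 1" m] by (simp add: subtopology_subtopology inf.absorb2)
  define d where "d = hom_boundary n (?X n) (skeleton K (n - 1)) c"
  have "exact_seq ([homology_group (n - 1 - 1) (subtopology (?X (n - 1)) (skeleton K (n - 2))),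
          relative_homology_group (n - 1) (?X (n - 1)) (skeleton K (n - 2)), homology_group (n - 1) (?X (n - 1))],
       [hom_boundary (n - 1) (?X (n - 1)) (skeleton K (n - 2)),
        hom_induced (n - 1) (?X (n - 1)) {} (?X (n - 1)) (skeleton K (n - 2)) id])"
    by (rule homology_exactness_axiom_1)
  \<comment> \<open>\<open>hom_boundary\<close> takes its values in the homology group at every
    argument, so exactness can be applied to \<open>d\<close>.\<close>
  moreover have "d \<in> carrier (homology_group (n - 1) (?X (n - 1)))"
    unfolding d_def s[symmetric] by (rule hom_boundary_carrier)
  ultimately have "hom_boundary (n - 1) (?X (n - 1)) (skeleton K (n - 2))
      (hom_induced (n - 1) (?X (n - 1)) {} (?X (n - 1)) (skeleton K (n - 2)) id d)
      = \<one>\<^bsub>homology_group (n - 1 - 1) (subtopology (?X (n - 1)) (skeleton K (n - 2)))\<^esub>"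
    by (auto simp: kernel_def simp del: one_relative_homology_group)
  then show ?thesis
    using s[of n] s[of "n - 1"]
      hom_one[OF hom_induced_hom[of "n - 1 - 1" "?X (n - 2)" "{}" "?X (n - 2)" "skeleton K (n - 3)" id]]
    by (simp add: cellular_boundary_map_def hom_relboundary_def cellular_group_def d_def[symmetric]
        del: one_relative_homology_group)
qed

lemma cellular_boundary_map_hom:
  "cellular_boundary_map K n \<in> hom (cellular_group K n) (cellular_group K (n - 1))"
proof -
  have "subtopology (subtopology (cw_space K) (skeleton K n)) (skeleton K (n - 1))
      = subtopology (cw_space K) (skeleton K (n - 1))"
    using skeleton_mono[of "n - 1" n] by (simp add: subtopology_subtopology inf.absorb2)
  then show ?thesis
    using group_homomorphism_hom_relboundary[of n "subtopology (cw_space K) (skeleton K n)"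
        "skeleton K (n - 1)" "skeleton K (n - 2)"]
    by (simp add: cellular_boundary_map_def cellular_group_def)
qed

text \<open>When the boundary of the boundary of \<sigma> is expanded in the classes of the cells
  two dimensions lower, this sum is the exponent of \<rho>. Independence of the classes makes it
  zero.\<close>

lemma incidence_squared:
  assumes or: "oriented_cells K" and inc: "incidence_coefficients K inc"
    and \<sigma>: "\<sigma> \<in> cw_cells K" 
  shows "(\<Sum>\<tau>\<in>cw_cells K. inc \<sigma> \<tau> * inc \<tau> \<rho>) = 0"
proof (cases "\<rho> \<in> cw_cells K \<and> int (cw_dim K \<rho>) = int (cw_dim K \<sigma>) - 2")
  case False
  \<comment> \<open>Outside the expected dimension every single product vanishes.\<close>
  have "inc \<sigma> \<tau> * inc \<tau> \<rho> = 0" for \<tau>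
  proof (rule ccontr)
    assume "inc \<sigma> \<tau> * inc \<tau> \<rho> \<noteq> 0"
    then have "inc \<sigma> \<tau> \<noteq> 0" "inc \<tau> \<rho> \<noteq> 0" by auto
    then have "cw_dim K \<sigma> = Suc (cw_dim K \<tau>)" "\<rho> \<in> cw_cells K" "cw_dim K \<tau> = Suc (cw_dim K \<rho>)"
      using inc unfolding incidence_coefficients_def by blast+
    then show False using False by simp
  qed
  then show ?thesis by simp
next
  case \<rho>: True
  define n where "n = int (cw_dim K \<sigma>)"
  let ?G = "\<lambda>m. cellular_group K m" let ?C = "\<lambda>m. {\<tau> \<in> cw_cells K. int (cw_dim K \<tau>) = m}"
  let ?d = "cellular_boundary_map K"
  have G: "comm_group (?G m)" for m by (simp add: cellular_group_def)
  interpret G1: comm_group "?G (n - 1)" by (rule G)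
  interpret G2: comm_group "?G (n - 2)" by (rule G)
  have hom: "?d (n - 1) \<in> hom (?G (n - 1)) (?G (n - 2))"
    using cellular_boundary_map_hom[of "n - 1"] by simp
  interpret group_hom "?G (n - 1)" "?G (n - 2)" "?d (n - 1)"
    using hom by (simp add: group_hom_def group_hom_axioms_def G1.is_group G2.is_group)
  have c: "cell_class K \<tau> \<in> carrier (?G m)" if "\<tau> \<in> ?C m" for \<tau> m
    using cell_class_carrier[of \<tau>] that by auto
  have b: "?d m (cell_class K \<tau>) = finprod (?G (m - 1)) (\<lambda>\<rho>. cell_class K \<rho> [^]\<^bsub>?G (m - 1)\<^esub> inc \<tau> \<rho>) (?C (m - 1))"
    if "\<tau> \<in> ?C m" for \<tau> m
    using inc that unfolding incidence_coefficients_def by (auto simp: Let_def)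
  have fin: "finite (?C m)" for m using finite_cw_cells by simp
  let ?f = "\<lambda>\<tau> \<rho>. cell_class K \<rho> [^]\<^bsub>?G (n - 2)\<^esub> (inc \<sigma> \<tau> * inc \<tau> \<rho>)"
  have f: "?f \<tau> \<rho> \<in> carrier (?G (n - 2))" if "\<rho> \<in> ?C (n - 2)" for \<tau> \<rho>
    using c[OF that] by (rule G2.int_pow_closed)
  \<comment> \<open>The contribution of one face \<tau> to the second boundary, expanded in the
    classes of its own faces.\<close>
  have step: "?d (n - 1) (cell_class K \<tau> [^]\<^bsub>?G (n - 1)\<^esub> inc \<sigma> \<tau>) = finprod (?G (n - 2)) (?f \<tau>) (?C (n - 2))"
    if \<tau>: "\<tau> \<in> ?C (n - 1)" for \<tau>
  proof -
    have "?d (n - 1) (cell_class K \<tau> [^]\<^bsub>?G (n - 1)\<^esub> inc \<sigma> \<tau>)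
        = ?d (n - 1) (cell_class K \<tau>) [^]\<^bsub>?G (n - 2)\<^esub> inc \<sigma> \<tau>"
      by (rule hom_int_pow[OF c[OF \<tau>]])
    also have "\<dots> = finprod (?G (n - 2)) (\<lambda>\<rho>. cell_class K \<rho> [^]\<^bsub>?G (n - 2)\<^esub> inc \<tau> \<rho>) (?C (n - 2)) [^]\<^bsub>?G (n - 2)\<^esub> inc \<sigma> \<tau>"
      using b[OF \<tau>] by simp
    also have "\<dots> = finprod (?G (n - 2)) (\<lambda>\<rho>. (cell_class K \<rho> [^]\<^bsub>?G (n - 2)\<^esub> inc \<tau> \<rho>) [^]\<^bsub>?G (n - 2)\<^esub> inc \<sigma> \<tau>) (?C (n - 2))"
      using c[of _ "n - 2"] by (intro finprod_int_pow[symmetric] G fin funcsetI G2.int_pow_closed)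
    also have "\<dots> = finprod (?G (n - 2)) (?f \<tau>) (?C (n - 2))"
      using c[of _ "n - 2"] f
      by (intro G2.finprod_cong' refl funcsetI) (simp_all add: G2.int_pow_pow mult.commute)
    finally show ?thesis .
  qed
  have ff: "finprod (?G (n - 2)) (?f \<tau>) (?C (n - 2)) \<in> carrier (?G (n - 2))" for \<tau>
    using f by (intro G2.finprod_closed funcsetI)
  have "\<one>\<^bsub>?G (n - 2)\<^esub> = ?d (n - 1) (?d n (cell_class K \<sigma>))"
    by (rule cellular_boundary_map_squared[symmetric])
  also have "\<dots> = ?d (n - 1) (finprod (?G (n - 1)) (\<lambda>\<tau>. cell_class K \<tau> [^]\<^bsub>?G (n - 1)\<^esub> inc \<sigma> \<tau>) (?C (n - 1)))"
    using b[of \<sigma> n] \<sigma> by (simp add: n_def)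
  also have "\<dots> = finprod (?G (n - 2)) (\<lambda>\<tau>. ?d (n - 1) (cell_class K \<tau> [^]\<^bsub>?G (n - 1)\<^esub> inc \<sigma> \<tau>)) (?C (n - 1))"
    using c[of _ "n - 1"] by (intro hom_finprod G hom fin funcsetI G1.int_pow_closed)
  also have "\<dots> = finprod (?G (n - 2)) (\<lambda>\<tau>. finprod (?G (n - 2)) (?f \<tau>) (?C (n - 2))) (?C (n - 1))"
    by (rule G2.finprod_cong'[OF refl funcsetI[OF ff] step])
  \<comment> \<open>Regrouping by \<rho> collects all exponents of one class.\<close>
  also have "\<dots> = finprod (?G (n - 2)) (\<lambda>\<rho>. finprod (?G (n - 2)) (\<lambda>\<tau>. ?f \<tau> \<rho>) (?C (n - 1))) (?C (n - 2))"
    by (rule finprod_swap[OF G fin fin f])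
  also have "\<dots> = finprod (?G (n - 2)) (\<lambda>\<rho>. cell_class K \<rho> [^]\<^bsub>?G (n - 2)\<^esub>
      (\<Sum>\<tau>\<in>?C (n - 1). inc \<sigma> \<tau> * inc \<tau> \<rho>)) (?C (n - 2))"
    using c[of _ "n - 2"]
    by (intro G2.finprod_cong' refl funcsetI finprod_int_pow_sum G fin G2.int_pow_closed)
  finally have "(\<Sum>\<tau>\<in>?C (n - 1). inc \<sigma> \<tau> * inc \<tau> \<rho>) = 0"
    using \<rho> by (intro cell_classes_independent[OF or, of \<rho> "n - 2"]) (auto simp: n_def)
  \<comment> \<open>Cells of other dimensions have incidence coefficient zero with \<sigma>, so they
    may be added to the range.\<close>
  moreover have "(\<Sum>\<tau>\<in>?C (n - 1). inc \<sigma> \<tau> * inc \<tau> \<rho>) = (\<Sum>\<tau>\<in>cw_cells K. inc \<sigma> \<tau> * inc \<tau> \<rho>)"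
  proof (intro sum.mono_neutral_left finite_cw_cells ballI)
    fix \<tau> assume "\<tau> \<in> cw_cells K - ?C (n - 1)"
    then have "cw_dim K \<sigma> \<noteq> Suc (cw_dim K \<tau>)" by (auto simp: n_def)
    then have "inc \<sigma> \<tau> = 0" using inc unfolding incidence_coefficients_def by blast
    then show "inc \<sigma> \<tau> * inc \<tau> \<rho> = 0" by simp
  qed simp
  ultimately show ?thesis by simp
qed

end

section \<open>Bases of quotients of function spaces\<close>

text \<open>An element of a quotient by \<open>B\<close>; \<open>homology_class\<close> is the
  instance where \<open>B\<close> consists of the boundaries.\<close>

definition fun_coset :: "('x \<Rightarrow> 'k::field) set \<Rightarrow> ('x \<Rightarrow> 'k) \<Rightarrow> ('x \<Rightarrow> 'k) set" where
  "fun_coset B z = {\<lambda>\<sigma>. z \<sigma> + b \<sigma> |b. b \<in> B}"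

definition fun_subspace :: "('x \<Rightarrow> 'k::field) set \<Rightarrow> bool" where
  "fun_subspace B \<longleftrightarrow> (\<lambda>_. 0) \<in> B \<and> (\<forall>x\<in>B. \<forall>y\<in>B. (\<lambda>\<sigma>. x \<sigma> + y \<sigma>) \<in> B) \<and>
     (\<forall>r. \<forall>x\<in>B. (\<lambda>\<sigma>. r * x \<sigma>) \<in> B)"

text \<open>Coefficients are attached to labels, so equal vectors under different labels stay apart;
  \<open>lincomb\<close> of a module attaches them to the vectors.\<close>

definition lin_comb :: "('i \<Rightarrow> 'k::field) \<Rightarrow> 'i set \<Rightarrow> ('i \<Rightarrow> 'x \<Rightarrow> 'k) \<Rightarrow> 'x \<Rightarrow> 'k" where
  "lin_comb a S z = (\<lambda>\<sigma>. \<Sum>v\<in>S. a v * z v \<sigma>)"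

lemma fun_subspaceD:
  assumes "fun_subspace B"
  shows "(\<lambda>_. 0) \<in> B" "x \<in> B \<Longrightarrow> y \<in> B \<Longrightarrow> (\<lambda>\<sigma>. x \<sigma> + y \<sigma>) \<in> B" "x \<in> B \<Longrightarrow> (\<lambda>\<sigma>. r * x \<sigma>) \<in> B"
    "x \<in> B \<Longrightarrow> y \<in> B \<Longrightarrow> (\<lambda>\<sigma>. x \<sigma> - y \<sigma>) \<in> B"
proof -
  show 1: "(\<lambda>_. 0) \<in> B" and 2: "x \<in> B \<Longrightarrow> y \<in> B \<Longrightarrow> (\<lambda>\<sigma>. x \<sigma> + y \<sigma>) \<in> B"
    and 3: "x \<in> B \<Longrightarrow> (\<lambda>\<sigma>. r * x \<sigma>) \<in> B" for x y r
    using assms unfolding fun_subspace_def by auto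
  show "(\<lambda>\<sigma>. x \<sigma> - y \<sigma>) \<in> B" if "x \<in> B" "y \<in> B"
    using 2[OF that(1) 3[OF that(2), of "-1"]] by simp
qed

lemma lin_comb_in_subspace:
  assumes "fun_subspace B" "\<And>v. v \<in> S \<Longrightarrow> z v \<in> B"
  shows "lin_comb a S z \<in> B"
  unfolding lin_comb_def using assms(2)
proof (induction S rule: infinite_finite_induct)
  case (insert v S)
  then show ?case
    using fun_subspaceD(2)[OF assms(1) fun_subspaceD(3)[OF assms(1), of "z v" "a v"]] by simp
qed (simp_all add: fun_subspaceD[OF assms(1)])

lemma fun_cosetI: "b \<in> B \<Longrightarrow> c = (\<lambda>\<sigma>. z \<sigma> + b \<sigma>) \<Longrightarrow> c \<in> fun_coset B z"
  by (auto simp: fun_coset_def)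

lemma fun_coset_eq_iff:
  assumes B: "fun_subspace B"
  shows "fun_coset B x = fun_coset B y \<longleftrightarrow> (\<lambda>\<sigma>. x \<sigma> - y \<sigma>) \<in> B"
proof
  assume "fun_coset B x = fun_coset B y"
  moreover have "x \<in> fun_coset B x" unfolding fun_coset_def using fun_subspaceD(1)[OF B] by force
  ultimately obtain b where "b \<in> B" "x = (\<lambda>\<sigma>. y \<sigma> + b \<sigma>)" unfolding fun_coset_def by auto
  then show "(\<lambda>\<sigma>. x \<sigma> - y \<sigma>) \<in> B" by simp
next
  have sub: "fun_coset B x \<subseteq> fun_coset B y" if xy: "(\<lambda>\<sigma>. x \<sigma> - y \<sigma>) \<in> B" for x y
  proof
    fix c assume "c \<in> fun_coset B x"
    then obtain b where b: "b \<in> B" "c = (\<lambda>\<sigma>. x \<sigma> + b \<sigma>)" unfolding fun_coset_def by auto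
    have "c = (\<lambda>\<sigma>. y \<sigma> + ((x \<sigma> - y \<sigma>) + b \<sigma>))" using b by auto
    then show "c \<in> fun_coset B y" by (rule fun_cosetI[OF fun_subspaceD(2)[OF B xy b(1)]])
  qed
  assume xy: "(\<lambda>\<sigma>. x \<sigma> - y \<sigma>) \<in> B"
  moreover have "(\<lambda>\<sigma>. y \<sigma> - x \<sigma>) \<in> B"
    using fun_subspaceD(3)[OF B xy, of "-1"] by simp
  ultimately show "fun_coset B x = fun_coset B y" using sub by blast
qed

lemma fun_coset_add:
  assumes B: "fun_subspace B"
  shows "{\<lambda>\<sigma>. a \<sigma> + b \<sigma> |a b. a \<in> fun_coset B x \<and> b \<in> fun_coset B y} = fun_coset B (\<lambda>\<sigma>. x \<sigma> + y \<sigma>)"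
proof (intro equalityI subsetI)
  fix c assume "c \<in> {\<lambda>\<sigma>. a \<sigma> + b \<sigma> |a b. a \<in> fun_coset B x \<and> b \<in> fun_coset B y}"
  then obtain a b where b: "a \<in> B" "b \<in> B" "c = (\<lambda>\<sigma>. (x \<sigma> + a \<sigma>) + (y \<sigma> + b \<sigma>))"
    unfolding fun_coset_def by blast
  then have "c = (\<lambda>\<sigma>. (x \<sigma> + y \<sigma>) + (a \<sigma> + b \<sigma>))" by (simp add: algebra_simps)
  then show "c \<in> fun_coset B (\<lambda>\<sigma>. x \<sigma> + y \<sigma>)"
    by (rule fun_cosetI[OF fun_subspaceD(2)[OF B b(1,2)]])
next
  fix c assume "c \<in> fun_coset B (\<lambda>\<sigma>. x \<sigma> + y \<sigma>)"
  then obtain b where b: "b \<in> B" "c = (\<lambda>\<sigma>. (x \<sigma> + y \<sigma>) + b \<sigma>)" unfolding fun_coset_def by auto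
  have "x \<in> fun_coset B x" by (rule fun_cosetI[OF fun_subspaceD(1)[OF B]]) simp
  moreover have "(\<lambda>\<sigma>. y \<sigma> + b \<sigma>) \<in> fun_coset B y" by (rule fun_cosetI[OF b(1) refl])
  moreover have "c = (\<lambda>\<sigma>. x \<sigma> + (y \<sigma> + b \<sigma>))" using b by (simp add: algebra_simps)
  ultimately show "c \<in> {\<lambda>\<sigma>. a \<sigma> + b \<sigma> |a b. a \<in> fun_coset B x \<and> b \<in> fun_coset B y}"
    unfolding mem_Collect_eq by (intro exI[of _ x] exI[of _ "\<lambda>\<sigma>. y \<sigma> + b \<sigma>"]) blast
qed

text \<open>For \<open>r = 0\<close> the scaled coset alone would be just the zero function; the
  summand from \<open>B\<close> restores a full coset.\<close>

lemma fun_coset_smult: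
  assumes B: "fun_subspace B"
  shows "{\<lambda>\<sigma>. r * a \<sigma> + b \<sigma> |a b. a \<in> fun_coset B x \<and> b \<in> B} = fun_coset B (\<lambda>\<sigma>. r * x \<sigma>)"
proof (intro equalityI subsetI)
  fix c assume "c \<in> {\<lambda>\<sigma>. r * a \<sigma> + b \<sigma> |a b. a \<in> fun_coset B x \<and> b \<in> B}"
  then obtain a b where b: "a \<in> B" "b \<in> B" "c = (\<lambda>\<sigma>. r * (x \<sigma> + a \<sigma>) + b \<sigma>)"
    unfolding fun_coset_def by blast
  then have "c = (\<lambda>\<sigma>. r * x \<sigma> + (r * a \<sigma> + b \<sigma>))" by (simp add: algebra_simps)
  then show "c \<in> fun_coset B (\<lambda>\<sigma>. r * x \<sigma>)"
    by (rule fun_cosetI[OF fun_subspaceD(2)[OF B fun_subspaceD(3)[OF B b(1)] b(2)]])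
next
  fix c assume "c \<in> fun_coset B (\<lambda>\<sigma>. r * x \<sigma>)"
  then obtain b where b: "b \<in> B" "c = (\<lambda>\<sigma>. r * x \<sigma> + b \<sigma>)" unfolding fun_coset_def by auto
  have "x \<in> fun_coset B x" by (rule fun_cosetI[OF fun_subspaceD(1)[OF B]]) simp
  then show "c \<in> {\<lambda>\<sigma>. r * a \<sigma> + b \<sigma> |a b. a \<in> fun_coset B x \<and> b \<in> B}"
    using b by blast
qed

text \<open>The module \<open>M\<close> is (Z + B) / B. This is the form of an image under a map
  induced by inclusion, with \<open>Z\<close> the cycles of the smaller complex and \<open>B\<close>
  the boundaries of the larger one. Work with cosets is confined to this proof: \<open>indep\<close>
  and \<open>span\<close> speak of representatives only.\<close>

lemma quotient_basis:
  fixes B Z :: "('x \<Rightarrow> 'k::field) set" and z :: "'i \<Rightarrow> 'x \<Rightarrow> 'k"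
  assumes B: "fun_subspace B" and Z: "fun_subspace Z" and S: "finite S" "\<And>v. v \<in> S \<Longrightarrow> z v \<in> Z"
    and indep: "\<And>a v. lin_comb a S z \<in> B \<Longrightarrow> v \<in> S \<Longrightarrow> a v = 0"
    and span: "\<And>c. c \<in> Z \<Longrightarrow> \<exists>a. (\<lambda>\<sigma>. c \<sigma> - lin_comb a S z \<sigma>) \<in> B"
    and M: "carrier M = fun_coset B ` Z" "\<zero>\<^bsub>M\<^esub> = B"
      "\<And>A A'. A \<oplus>\<^bsub>M\<^esub> A' = {\<lambda>\<sigma>. a \<sigma> + b \<sigma> |a b. a \<in> A \<and> b \<in> A'}"
      "\<And>r A. r \<odot>\<^bsub>M\<^esub> A = {\<lambda>\<sigma>. r * a \<sigma> + b \<sigma> |a b. a \<in> A \<and> b \<in> B}"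
  shows "inj_on (\<lambda>v. fun_coset B (z v)) S \<and> vectorspace.basis class_ring M ((\<lambda>v. fun_coset B (z v)) ` S)"
proof
  let ?g = "\<lambda>v. fun_coset B (z v)"
  have zero: "\<zero>\<^bsub>M\<^esub> = fun_coset B (\<lambda>_. 0)" by (simp add: M fun_coset_def)
  have add: "fun_coset B x \<oplus>\<^bsub>M\<^esub> fun_coset B y = fun_coset B (\<lambda>\<sigma>. x \<sigma> + y \<sigma>)" for x y
    by (simp add: M fun_coset_add[OF B])
  have smult: "r \<odot>\<^bsub>M\<^esub> fun_coset B x = fun_coset B (\<lambda>\<sigma>. r * x \<sigma>)" for r x
    by (simp add: M fun_coset_smult[OF B])
  note Zc = fun_subspaceD[OF Z]
  show inj: "inj_on ?g S"
  proof (rule inj_onI, rule ccontr)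
    fix v w assume vw: "v \<in> S" "w \<in> S" "?g v = ?g w" "v \<noteq> w"
    \<comment> \<open>Equal cosets put the difference of z v and z w into \<open>B\<close>; its
      coefficients 1 and -1 contradict \<open>indep\<close>.\<close>
    let ?a = "\<lambda>u. if u = v then 1 else if u = w then - 1 else 0"
    have "lin_comb ?a S z = (\<lambda>\<sigma>. z v \<sigma> - z w \<sigma>)"
    proof
      fix \<sigma>
      have "lin_comb ?a S z \<sigma> = (\<Sum>u\<in>S. (if u = v then z v \<sigma> else 0) + (if u = w then - z w \<sigma> else 0))"
        unfolding lin_comb_def using vw(4) by (intro sum.cong) auto
      then show "lin_comb ?a S z \<sigma> = z v \<sigma> - z w \<sigma>"
        using vw S(1) by (simp add: sum.distrib)
    qed
    then have "lin_comb ?a S z \<in> B" using vw(3) by (simp add: fun_coset_eq_iff[OF B])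
    from indep[OF this vw(1)] show False by simp
  qed
  interpret vectorspace "class_ring :: 'k ring" M
  proof (rule vs_criteria)
    show "field (class_ring :: 'k ring)" by (rule class_field)
    show "\<zero>\<^bsub>M\<^esub> \<in> carrier M" unfolding zero M(1) using Zc(1) by blast
    show "\<forall>v w. v \<in> carrier M \<and> w \<in> carrier M \<longrightarrow> v \<oplus>\<^bsub>M\<^esub> w \<in> carrier M"
      using Zc(2) by (auto simp: M(1) add)
    show "\<forall>v\<in>carrier M. \<exists>neg_v\<in>carrier M. v \<oplus>\<^bsub>M\<^esub> neg_v = \<zero>\<^bsub>M\<^esub>"
    proof
      fix v assume "v \<in> carrier M"
      then obtain x where x: "x \<in> Z" "v = fun_coset B x" by (auto simp: M(1))
      have "fun_coset B (\<lambda>\<sigma>. - 1 * x \<sigma>) \<in> carrier M" unfolding M(1) using Zc(3)[OF x(1), of "- 1"] by blast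
      moreover have "v \<oplus>\<^bsub>M\<^esub> fun_coset B (\<lambda>\<sigma>. - 1 * x \<sigma>) = \<zero>\<^bsub>M\<^esub>"
        unfolding x(2) add zero by simp
      ultimately show "\<exists>neg_v\<in>carrier M. v \<oplus>\<^bsub>M\<^esub> neg_v = \<zero>\<^bsub>M\<^esub>" by blast
    qed
  qed (use Zc in \<open>auto simp: M(1) add smult zero algebra_simps\<close>)
  \<comment> \<open>Sums in the module are computed on representatives.\<close>
  have fs: "(\<Oplus>\<^bsub>M\<^esub>v\<in>T. b v \<odot>\<^bsub>M\<^esub> ?g v) = fun_coset B (lin_comb b T z)" if "T \<subseteq> S" for b T
  proof -
    have "finite T" using that S(1) finite_subset by blast
    then show ?thesis using that
    proof induction
      case empty
      then show ?case by (simp add: zero lin_comb_def)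
    next
      case (insert v T)
      have "(\<lambda>v. b v \<odot>\<^bsub>M\<^esub> ?g v) \<in> T \<rightarrow> carrier M" "b v \<odot>\<^bsub>M\<^esub> ?g v \<in> carrier M"
        using insert.prems S(2) Zc(3) by (auto simp: smult M(1))
      then have "(\<Oplus>\<^bsub>M\<^esub>v\<in>insert v T. b v \<odot>\<^bsub>M\<^esub> ?g v) = (b v \<odot>\<^bsub>M\<^esub> ?g v) \<oplus>\<^bsub>M\<^esub> (\<Oplus>\<^bsub>M\<^esub>v\<in>T. b v \<odot>\<^bsub>M\<^esub> ?g v)"
        using insert.hyps by (intro M.finsum_insert) auto
      also have "\<dots> = fun_coset B (\<lambda>\<sigma>. b v * z v \<sigma> + lin_comb b T z \<sigma>)"
        using insert by (simp add: smult add)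
      finally show ?case using insert.hyps by (simp add: lin_comb_def)
    qed
  qed
  have gM: "?g ` S \<subseteq> carrier M" using S(2) by (auto simp: M(1))
  have lc: "lincomb a (?g ` S) = fun_coset B (lin_comb (\<lambda>v. a (?g v)) S z)" for a
  proof -
    have "lincomb a (?g ` S) = (\<Oplus>\<^bsub>M\<^esub>v\<in>S. a (?g v) \<odot>\<^bsub>M\<^esub> ?g v)"
      unfolding lincomb_def using gM inj by (subst M.finsum_reindex) auto
    then show ?thesis using fs[of S] by simp
  qed
  have "lin_indpt (?g ` S)"
  proof (rule finite_lin_indpt2[OF finite_imageI[OF S(1)] gM])
    fix a assume "lincomb a (?g ` S) = \<zero>\<^bsub>M\<^esub>"
    then have "lin_comb (\<lambda>v. a (?g v)) S z \<in> B"
      unfolding lc zero fun_coset_eq_iff[OF B] by simp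
    then show "\<forall>v\<in>?g ` S. a v = \<zero>\<^bsub>class_ring\<^esub>" using indep by auto
  qed
  moreover have "span (?g ` S) = carrier M"
  proof
    show "span (?g ` S) \<subseteq> carrier M" using gM by (rule span_is_subset2)
    show "carrier M \<subseteq> span (?g ` S)"
    proof
      fix x assume "x \<in> carrier M"
      then obtain c where c: "c \<in> Z" "x = fun_coset B c" by (auto simp: M(1))
      obtain a where a: "(\<lambda>\<sigma>. c \<sigma> - lin_comb a S z \<sigma>) \<in> B" using span[OF c(1)] by blast
      \<comment> \<open>\<open>lincomb\<close> takes coefficients on cosets; injectivity lets them
        be read back from the labels.\<close>
      let ?b = "\<lambda>w. a (the_inv_into S ?g w)"
      have "lin_comb (\<lambda>v. ?b (?g v)) S z = lin_comb a S z"
        unfolding lin_comb_def using the_inv_into_f_f[OF inj] by (intro ext sum.cong) auto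
      then have "lincomb ?b (?g ` S) = x"
        unfolding lc c(2) using a fun_coset_eq_iff[OF B] by metis
      then show "x \<in> span (?g ` S)"
        unfolding finite_span[OF finite_imageI[OF S(1)] gM] by auto
    qed
  qed
  ultimately show "basis (?g ` S)" unfolding basis_def using gM by simp
qed

lemma lin_comb_diff: "lin_comb (\<lambda>v. a v - b v) S z \<sigma> = lin_comb a S z \<sigma> - lin_comb b S z \<sigma>"
  by (simp add: lin_comb_def sum_subtractf algebra_simps)

lemma lin_comb_mono_neutral:
  assumes "finite T" "S \<subseteq> T" "\<And>v. v \<in> T - S \<Longrightarrow> a v = 0 \<or> z v = (\<lambda>_. 0)"
  shows "lin_comb a S z = lin_comb a T z"
proof
  fix \<sigma>
  have "a v * z v \<sigma> = 0" if "v \<in> T - S" for v using assms(3)[OF that] by auto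
  then show "lin_comb a S z \<sigma> = lin_comb a T z \<sigma>"
    unfolding lin_comb_def using assms(1,2) by (intro sum.mono_neutral_left) auto
qed

section \<open>Distinct lows and cellular chains\<close>

text \<open>Among the indices with nonzero coefficient, take the one with the largest
  \<open>l\<close>. At that position all other terms vanish, so its own term would have to vanish as
  well.\<close>

lemma distinct_lows_independent:
  fixes w :: "'i \<Rightarrow> nat \<Rightarrow> 'k::field" and l :: "'i \<Rightarrow> nat"
  assumes "finite J" and inj: "inj_on l J" and nz: "\<And>j. j \<in> J \<Longrightarrow> w j (l j) \<noteq> 0"
    and above: "\<And>j k. j \<in> J \<Longrightarrow> k \<in> J \<Longrightarrow> l k < l j \<Longrightarrow> w k (l j) = 0"
    and zero: "\<And>j. j \<in> J \<Longrightarrow> lin_comb a J w (l j) = 0"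
    and "j \<in> J"
  shows "a j = 0"
proof (rule ccontr)
  assume "a j \<noteq> 0"
  define J' where "J' = {j \<in> J. a j \<noteq> 0}"
  have "finite J'" "J' \<noteq> {}" using assms \<open>a j \<noteq> 0\<close> by (auto simp: J'_def)
  then obtain m where m: "m \<in> J'" "\<And>k. k \<in> J' \<Longrightarrow> l k \<le> l m"
    using finite_imageI[of J' l] Max_in[of "l ` J'"] Max_ge[of "l ` J'"] by fastforce
  have mJ: "m \<in> J" "a m \<noteq> 0" using m by (auto simp: J'_def)
  have "a k * w k (l m) = 0" if "k \<in> J" "k \<noteq> m" for k
  proof (cases "k \<in> J'")
    case True
    then have "l k < l m" using m(2)[OF True] inj that mJ by (auto simp: inj_on_def le_less)
    then show ?thesis using above[OF mJ(1) that(1)] by simp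
  next
    case False then show ?thesis using that by (simp add: J'_def)
  qed
  then have "lin_comb a J w (l m) = (\<Sum>k\<in>J. if k = m then a m * w m (l m) else 0)"
    unfolding lin_comb_def by (intro sum.cong) auto
  also have "\<dots> = a m * w m (l m)" using assms(1) mJ by simp
  finally show False using zero[OF mJ(1)] nz[OF mJ(1)] mJ(2) by simp
qed

text \<open>For a nonzero vector the set in \<open>low\<close> is nonempty, so the maximum is
  attained.\<close>

lemma low_vec:
  assumes "c \<in> carrier_vec N" "c \<noteq> 0\<^sub>v N"
  shows "low c < N" "c $ low c \<noteq> 0" "\<And>i. low c < i \<Longrightarrow> i < N \<Longrightarrow> c $ i = 0"
proof -
  let ?A = "{i. i < dim_vec c \<and> c $ i \<noteq> 0}"
  have fin: "finite ?A" by simp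
  have "?A \<noteq> {}" using assms by (metis (mono_tags, lifting) carrier_vecD empty_Collect_eq eq_vecI index_zero_vec)
  from Max_in[OF fin this] have "low c \<in> ?A" by (simp only: low_def)
  then show "low c < N" "c $ low c \<noteq> 0" using assms(1) by auto
  show "c $ i = 0" if "low c < i" "i < N" for i
  proof (rule ccontr)
    assume "c $ i \<noteq> 0"
    then have "i \<le> low c" unfolding low_def using that assms(1) fin by (intro Max_ge) auto
    then show False using that by simp
  qed
qed

section \<open>Linearity of the boundary; chains, cycles and boundaries as subspaces\<close>

lemma chain_boundary_add:
  "chain_boundary K inc (\<lambda>\<sigma>. x \<sigma> + y \<sigma>) = (\<lambda>\<sigma>. chain_boundary K inc x \<sigma> + chain_boundary K inc y \<sigma>)"
  by (simp add: chain_boundary_def algebra_simps sum.distrib)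

lemma chain_boundary_smult:
  "chain_boundary K inc (\<lambda>\<sigma>. r * x \<sigma>) = (\<lambda>\<sigma>. r * chain_boundary K inc x \<sigma>)"
  by (simp add: chain_boundary_def sum_distrib_left mult.assoc)

lemma chain_boundary_zero: "chain_boundary K inc (\<lambda>_. 0) = (\<lambda>_. 0)"
  by (simp add: chain_boundary_def)

lemma chain_boundary_lin_comb:
  "chain_boundary K inc (lin_comb a J z) = lin_comb a J (\<lambda>j. chain_boundary K inc (z j))"
proof
  fix \<tau>
  have "chain_boundary K inc (lin_comb a J z) \<tau> = (\<Sum>\<sigma>\<in>cw_cells K. \<Sum>j\<in>J. a j * (z j \<sigma> * of_int (inc \<sigma> \<tau>)))"
    by (simp add: chain_boundary_def lin_comb_def sum_distrib_right mult.assoc)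
  also have "\<dots> = (\<Sum>j\<in>J. \<Sum>\<sigma>\<in>cw_cells K. a j * (z j \<sigma> * of_int (inc \<sigma> \<tau>)))"
    by (rule sum.swap)
  finally show "chain_boundary K inc (lin_comb a J z) \<tau> = lin_comb a J (\<lambda>j. chain_boundary K inc (z j)) \<tau>"
    by (simp add: chain_boundary_def lin_comb_def sum_distrib_left)
qed

lemma fun_subspace_cell_chains:
  "fun_subspace (cell_chains K q L :: ('a set \<Rightarrow> 'k::field) set)"
  unfolding fun_subspace_def cell_chains_def
proof (intro conjI ballI allI CollectI impI)
  fix x y :: "'a set \<Rightarrow> 'k" and \<sigma> :: "'a set"
  assume "x \<in> {c. \<forall>\<sigma>. c \<sigma> \<noteq> 0 \<longrightarrow> \<sigma> \<in> L \<and> cw_dim K \<sigma> = q}" "y \<in> {c. \<forall>\<sigma>. c \<sigma> \<noteq> 0 \<longrightarrow> \<sigma> \<in> L \<and> cw_dim K \<sigma> = q}"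
    and "x \<sigma> + y \<sigma> \<noteq> 0"
  moreover from this(3) have "x \<sigma> \<noteq> 0 \<or> y \<sigma> \<noteq> 0" by auto
  ultimately show "\<sigma> \<in> L" "cw_dim K \<sigma> = q" by auto
qed auto

lemma fun_subspace_cell_cycles:
  "fun_subspace (cell_cycles K inc q L :: ('a set \<Rightarrow> 'k::field) set)"
proof -
  note D = fun_subspaceD[OF fun_subspace_cell_chains[of K q L]]
  show ?thesis
    unfolding fun_subspace_def cell_cycles_def
  proof (intro conjI ballI allI CollectI)
    fix x y :: "'a set \<Rightarrow> 'k" and r
    assume x: "x \<in> {c \<in> cell_chains K q L. chain_boundary K inc c = (\<lambda>_. 0)}"
    then show "(\<lambda>\<sigma>. r * x \<sigma>) \<in> cell_chains K q L" "chain_boundary K inc (\<lambda>\<sigma>. r * x \<sigma>) = (\<lambda>_. 0)"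
      by (simp_all add: D chain_boundary_smult)
    assume "y \<in> {c \<in> cell_chains K q L. chain_boundary K inc c = (\<lambda>_. 0)}"
    with x show "(\<lambda>\<sigma>. x \<sigma> + y \<sigma>) \<in> cell_chains K q L" "chain_boundary K inc (\<lambda>\<sigma>. x \<sigma> + y \<sigma>) = (\<lambda>_. 0)"
      by (simp_all add: D chain_boundary_add)
  qed (simp_all add: D chain_boundary_zero)
qed

lemma fun_subspace_cell_boundaries:
  "fun_subspace (cell_boundaries K inc q L :: ('a set \<Rightarrow> 'k::field) set)"
proof -
  note D = fun_subspaceD[OF fun_subspace_cell_chains[of K "Suc q" L]]
  show ?thesis
    unfolding fun_subspace_def cell_boundaries_def
  proof (intro conjI ballI allI)
    show "(\<lambda>_. 0) \<in> chain_boundary K inc ` cell_chains K (Suc q) L"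
      by (rule image_eqI[where x = "\<lambda>_. 0"]) (simp_all add: D chain_boundary_zero)
  next
    fix x y :: "'a set \<Rightarrow> 'k"
    assume "x \<in> chain_boundary K inc ` cell_chains K (Suc q) L" "y \<in> chain_boundary K inc ` cell_chains K (Suc q) L"
    then obtain u v where "u \<in> cell_chains K (Suc q) L" "v \<in> cell_chains K (Suc q) L"
      "x = chain_boundary K inc u" "y = chain_boundary K inc v" by auto
    then show "(\<lambda>\<sigma>. x \<sigma> + y \<sigma>) \<in> chain_boundary K inc ` cell_chains K (Suc q) L"
      using D(2)[of u v] chain_boundary_add[of K inc u v]
      by (intro image_eqI[of _ _ "\<lambda>\<sigma>. u \<sigma> + v \<sigma>"]) auto
  next
    fix r and x :: "'a set \<Rightarrow> 'k"
    assume "x \<in> chain_boundary K inc ` cell_chains K (Suc q) L"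
    then obtain u where "u \<in> cell_chains K (Suc q) L" "x = chain_boundary K inc u" by auto
    then show "(\<lambda>\<sigma>. r * x \<sigma>) \<in> chain_boundary K inc ` cell_chains K (Suc q) L"
      using D(3)[of u r] chain_boundary_smult[of K inc r u]
      by (intro image_eqI[of _ _ "\<lambda>\<sigma>. r * u \<sigma>"]) auto
  qed
qed

text \<open>After the sums are exchanged, each c \<sigma> is multiplied by the integer sum of
  \<open>incidence_squared\<close>, carried into the field by \<open>of_int\<close>.\<close>

lemma chain_boundary_squared:
  assumes "finite_cw_complex K" "oriented_cells K" "incidence_coefficients K inc"
  shows "chain_boundary K inc (chain_boundary K inc c) = (\<lambda>_. 0)"
proof
  fix \<rho>
  have "chain_boundary K inc (chain_boundary K inc c) \<rho>
      = (\<Sum>\<tau>\<in>cw_cells K. \<Sum>\<sigma>\<in>cw_cells K. c \<sigma> * of_int (inc \<sigma> \<tau> * inc \<tau> \<rho>))"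
    by (simp add: chain_boundary_def sum_distrib_right mult.assoc)
  also have "\<dots> = (\<Sum>\<sigma>\<in>cw_cells K. \<Sum>\<tau>\<in>cw_cells K. c \<sigma> * of_int (inc \<sigma> \<tau> * inc \<tau> \<rho>))"
    by (rule sum.swap)
  also have "\<dots> = (\<Sum>\<sigma>\<in>cw_cells K. c \<sigma> * of_int (\<Sum>\<tau>\<in>cw_cells K. inc \<sigma> \<tau> * inc \<tau> \<rho>))"
    by (simp add: sum_distrib_left)
  also have "\<dots> = 0"
    using incidence_squared[OF assms] by (intro sum.neutral) simp
  finally show "chain_boundary K inc (chain_boundary K inc c) \<rho> = 0" .
qed

section \<open>Birth cycles and boundaries\<close>

text \<open>One notion for the sublevel sets and for the segments of the order cut off before an
  index. As \<open>V\<close> is upper triangular, a column whose own cell lies in such a set is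
  supported in it.\<close>

definition initial :: "'a set list \<Rightarrow> 'a set set \<Rightarrow> bool" where
  "initial cs L \<longleftrightarrow> (\<forall>j<length cs. cs ! j \<in> L \<longrightarrow> (\<forall>i\<le>j. cs ! i \<in> L))"

definition cell_indices :: "'a cw_complex \<Rightarrow> 'a set list \<Rightarrow> nat \<Rightarrow> 'a set set \<Rightarrow> nat set" where
  "cell_indices K cs q L = {j. j < length cs \<and> cs ! j \<in> L \<and> cw_dim K (cs ! j) = q}"

context
  fixes K :: "'a cw_complex" and inc :: "'a set \<Rightarrow> 'a set \<Rightarrow> int" and f :: "'a set \<Rightarrow> real"
    and cs :: "'a set list" and R V :: "'k::field mat"
  assumes cw: "finite_cw_complex K" "oriented_cells K" "incidence_coefficients K inc"
    and order: "filtration_order K f cs"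
    and V: "V \<in> carrier_mat (length cs) (length cs)" "upper_unitriangular V"
      "dimension_preserving K cs V"
    and R: "R = boundary_matrix inc cs * V" "reduced_matrix R"
begin

text \<open>Here \<open>zc j\<close> stands for every column of \<open>V\<close>; it is a cycle just
  when \<open>positive R j\<close>. Accordingly \<open>rc j\<close> is column \<open>j\<close> of
  \<open>R\<close> as a chain.\<close>

private abbreviation (input) "zc \<equiv> birth_cycle cs V"
private abbreviation (input) "rc \<equiv> \<lambda>j. chain_boundary K inc (birth_cycle cs V j)"

section \<open>Columns of \<open>V\<close> and \<open>R\<close> as chains\<close>

lemma distinct_cells: "distinct cs" and set_cells: "set cs = cw_cells K"
  using order by (auto simp: filtration_order_def)

lemma cell_eq_nth: "\<sigma> \<in> cw_cells K \<Longrightarrow> \<exists>i<length cs. \<sigma> = cs ! i"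
  using set_cells by (metis in_set_conv_nth)

lemma nth_cell: "i < length cs \<Longrightarrow> cs ! i \<in> cw_cells K"
  using set_cells nth_mem by blast

text \<open>A strict drop of \<open>f\<close> would reverse the order of the indices.\<close>

lemma filtration_mono: "i \<le> j \<Longrightarrow> j < length cs \<Longrightarrow> f (cs ! i) \<le> f (cs ! j)"
  using order unfolding filtration_order_def by (meson le_less_trans not_le)

lemma birth_cycle_nth:
  assumes "i < length cs" "j < length cs"
  shows "zc j (cs ! i) = V $$ (i, j)"
proof -
  have "zc j (cs ! i) = (\<Sum>l<length cs. if l = i then col V j $ i else 0)"
    unfolding birth_cycle_def column_chain_def using assms nth_eq_iff_index_eq[OF distinct_cells]
    by (intro sum.cong) auto
  then show ?thesis using assms V(1) by simp
qed

lemma birth_cycle_outside: "\<sigma> \<notin> cw_cells K \<Longrightarrow> zc j \<sigma> = 0"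
  using nth_cell unfolding birth_cycle_def column_chain_def by (intro sum.neutral) auto

lemma birth_cycle_diag: "j < length cs \<Longrightarrow> zc j (cs ! j) = 1"
  using V by (simp add: birth_cycle_nth upper_unitriangular_def)

lemma birth_cycle_above: "j < i \<Longrightarrow> i < length cs \<Longrightarrow> zc j (cs ! i) = 0"
  using V by (simp add: birth_cycle_nth upper_unitriangular_def upper_triangular_def)

text \<open>Upper triangularity keeps the support at positions up to \<open>j\<close>, and
  preservation of dimension keeps it in one degree.\<close>

lemma birth_cycle_chain:
  assumes "j < length cs" "\<And>i. i \<le> j \<Longrightarrow> cs ! i \<in> L"
  shows "zc j \<in> cell_chains K (cw_dim K (cs ! j)) L"
  unfolding cell_chains_def
proof (intro CollectI allI impI)
  fix \<sigma> assume nz: "zc j \<sigma> \<noteq> 0"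
  then obtain i where i: "i < length cs" "\<sigma> = cs ! i"
    using birth_cycle_outside cell_eq_nth by blast
  then have "i \<le> j" using nz birth_cycle_above[of j i] by (meson not_le)
  moreover have "cw_dim K \<sigma> = cw_dim K (cs ! j)"
    using nz i V(3) assms(1) by (auto simp: dimension_preserving_def birth_cycle_nth)
  ultimately show "\<sigma> \<in> L \<and> cw_dim K \<sigma> = cw_dim K (cs ! j)" using assms(2) i by blast
qed

lemma chain_boundary_outside: "\<sigma> \<notin> cw_cells K \<Longrightarrow> chain_boundary K inc c \<sigma> = 0"
  using cw(3) unfolding chain_boundary_def incidence_coefficients_def
  by (intro sum.neutral) (metis mult_zero_right of_int_0)

text \<open>This is \<open>R = DV\<close> entry by entry, with the sum over cells reindexed by
  positions in \<open>cs\<close>.\<close>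

lemma boundary_birth_cycle_nth:
  assumes "i < length cs" "j < length cs"
  shows "rc j (cs ! i) = R $$ (i, j)"
proof -
  have "rc j (cs ! i) = (\<Sum>\<sigma>\<in>(!) cs ` {..<length cs}. zc j \<sigma> * of_int (inc \<sigma> (cs ! i)))"
    unfolding chain_boundary_def set_cells[symmetric] by (simp add: set_conv_nth image_def Bex_def conj_commute)
  also have "\<dots> = (\<Sum>l<length cs. zc j (cs ! l) * of_int (inc (cs ! l) (cs ! i)))"
    using distinct_cells by (subst sum.reindex) (auto intro!: inj_onI simp: nth_eq_iff_index_eq)
  also have "\<dots> = (\<Sum>l<length cs. of_int (inc (cs ! l) (cs ! i)) * V $$ (l, j))"
    using assms by (intro sum.cong) (simp_all add: birth_cycle_nth)
  also have "\<dots> = R $$ (i, j)"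
    using assms V(1) by (simp add: R(1) boundary_matrix_def scalar_prod_def lessThan_atLeast0)
  finally show ?thesis .
qed

lemma R_dim: "dim_row R = length cs" "dim_col R = length cs"
  using V(1) by (simp_all add: R(1) boundary_matrix_def)

text \<open>A column only records values on cells; elsewhere the boundary vanishes because the
  incidence coefficients do.\<close>

lemma positive_iff:
  assumes "j < length cs"
  shows "positive R j \<longleftrightarrow> rc j = (\<lambda>_. 0)"
proof
  assume p: "positive R j"
  show "rc j = (\<lambda>_. 0)"
  proof
    fix \<sigma> show "rc j \<sigma> = 0"
    proof (cases "\<sigma> \<in> cw_cells K")
      case True
      then obtain i where "i < length cs" "\<sigma> = cs ! i" using cell_eq_nth by blast
      moreover from this have "col R j $ i = 0" using p R_dim by (simp add: positive_def)
      ultimately show ?thesis using assms R_dim by (simp add: boundary_birth_cycle_nth)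
    qed (rule chain_boundary_outside)
  qed
next
  assume "rc j = (\<lambda>_. 0)"
  then have "R $$ (i, j) = 0" if "i < length cs" for i
    using boundary_birth_cycle_nth[OF that assms] by metis
  then show "positive R j" unfolding positive_def using assms R_dim by (intro eq_vecI) auto
qed

lemma low_boundary:
  assumes "j < length cs" "\<not> positive R j"
  shows "low (col R j) < length cs" "rc j (cs ! low (col R j)) \<noteq> 0"
    "\<And>i. low (col R j) < i \<Longrightarrow> i < length cs \<Longrightarrow> rc j (cs ! i) = 0"
proof -
  have c: "col R j \<in> carrier_vec (length cs)"
    by (rule carrier_vecI) (simp add: R_dim)
  have nz: "col R j \<noteq> 0\<^sub>v (length cs)"
    using assms(2) unfolding positive_def R_dim .
  note l = low_vec[OF c nz]
  have eq: "rc j (cs ! i) = col R j $ i" if "i < length cs" for i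
    using that assms(1) by (simp add: boundary_birth_cycle_nth R_dim)
  show "low (col R j) < length cs" by (rule l)
  show "rc j (cs ! low (col R j)) \<noteq> 0" unfolding eq[OF l(1)] by (rule l)
  show "rc j (cs ! i) = 0" if "low (col R j) < i" "i < length cs" for i
    unfolding eq[OF that(2)] using l(3)[OF that] .
qed

section \<open>Distinct lows and the pairing\<close>

lemma low_inj:
  assumes "j < length cs" "k < length cs" "\<not> positive R j" "\<not> positive R k" "low (col R j) = low (col R k)"
  shows "j = k"
  using R(2)[unfolded reduced_matrix_def R_dim positive_def[symmetric]] assms
  unfolding positive_def R_dim by blast

text \<open>As the matrix is reduced, \<open>k\<close> is the only witness for the definite
  description in \<open>pair\<close>.\<close>

lemma pair_eq:
  assumes "k < length cs" "\<not> positive R k" "low (col R k) = i"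
  shows "pair R i = enat k"
proof -
  have "pairs_with R i k' \<longleftrightarrow> k' = k" for k'
    using assms low_inj[of k' k] R_dim unfolding pairs_with_def positive_def by auto
  then have "pairs_with R i = (\<lambda>k'. k' = k)" by blast
  then show ?thesis by (simp add: pair_def)
qed

lemma pair_enatD:
  assumes "pair R i = enat k"
  shows "k < length cs" "\<not> positive R k" "low (col R k) = i"
proof -
  obtain k' where k': "pairs_with R i k'" using assms by (auto simp: pair_def split: if_splits)
  then have "k' < length cs" "\<not> positive R k'" "low (col R k') = i"
    using R_dim by (auto simp: pairs_with_def positive_def)
  moreover from this have "k' = k" using pair_eq[of k' i] assms by simp
  ultimately show "k < length cs" "\<not> positive R k" "low (col R k) = i" by auto
qed

text \<open>Unitriangular elimination from the top: the last nonzero position is cleared with the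
  column of the same index. Since \<open>L\<close> is initial, the subtracted column is a chain on
  \<open>L\<close>.\<close>

lemma chain_eq_lin_comb:
  assumes L: "initial cs L" "L \<subseteq> cw_cells K" and c: "c \<in> cell_chains K q L"
  shows "\<exists>a. c = lin_comb a (cell_indices K cs q L) zc"
proof -
  have fin: "finite (cell_indices K cs q L)" by (simp add: cell_indices_def)
  \<comment> \<open>The induction is on a bound \<open>m\<close> from which on the chain vanishes;
    \<open>length cs\<close> is such a bound for every chain.\<close>
  have "\<exists>a. c = lin_comb a (cell_indices K cs q L) zc"
    if "c \<in> cell_chains K q L" "\<And>i. m \<le> i \<Longrightarrow> i < length cs \<Longrightarrow> c (cs ! i) = 0" for m c
    using that
  proof (induction m arbitrary: c)
    case 0
    have "c \<sigma> = 0" for \<sigma>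
    proof (rule ccontr)
      assume nz: "c \<sigma> \<noteq> 0"
      then have "\<sigma> \<in> cw_cells K" using 0(1) L(2) by (auto simp: cell_chains_def)
      then obtain i where "i < length cs" "\<sigma> = cs ! i" using cell_eq_nth by blast
      then show False using 0(2)[of i] nz by simp
    qed
    then have "c = lin_comb (\<lambda>_. 0) (cell_indices K cs q L) zc" by (auto simp: lin_comb_def)
    then show ?case by blast
  next
    case (Suc m)
    show ?case
    proof (cases "m < length cs \<and> c (cs ! m) \<noteq> 0")
      case False
      then have "c (cs ! i) = 0" if "m \<le> i" "i < length cs" for i
        using Suc.prems(2)[of i] that by (cases "i = m") auto
      then show ?thesis using Suc.IH Suc.prems(1) by blast
    next
      case True
      \<comment> \<open>The diagonal of \<open>V\<close> is 1, so subtracting \<open>e\<close> times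
        column \<open>m\<close> clears position \<open>m\<close> and leaves the later ones
        zero.\<close>
      define e where "e = c (cs ! m)"
      have m: "m \<in> cell_indices K cs q L"
        using True Suc.prems(1) unfolding cell_chains_def cell_indices_def by auto
      then have zm: "zc m \<in> cell_chains K q L"
        using birth_cycle_chain[of m L] L(1) by (auto simp: cell_indices_def initial_def)
      note D = fun_subspaceD[OF fun_subspace_cell_chains[of K q L]]
      let ?c = "\<lambda>\<sigma>. c \<sigma> - e * zc m \<sigma>"
      have "?c \<in> cell_chains K q L" using D(4)[OF Suc.prems(1) D(3)[OF zm]] .
      moreover have "?c (cs ! i) = 0" if "m \<le> i" "i < length cs" for i
        using Suc.prems(2)[of i] that birth_cycle_above[of m i] birth_cycle_diag[of m]
        by (cases "i = m") (auto simp: e_def)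
      ultimately obtain a where a: "?c = lin_comb a (cell_indices K cs q L) zc" using Suc.IH by blast
      \<comment> \<open>The coefficient at \<open>m\<close> grows by \<open>e\<close>, written as a
        difference with \<open>- e\<close> to fit \<open>lin_comb_diff\<close>.\<close>
      have "c = lin_comb (\<lambda>j. a j - (if j = m then - e else 0)) (cell_indices K cs q L) zc"
      proof
        fix \<sigma>
        have "lin_comb (\<lambda>j. if j = m then - e else 0) (cell_indices K cs q L) zc \<sigma>
            = (\<Sum>j\<in>cell_indices K cs q L. if j = m then - e * zc m \<sigma> else 0)"
          unfolding lin_comb_def by (intro sum.cong) auto
        also have "\<dots> = - e * zc m \<sigma>" using m fin by simp
        finally show "c \<sigma> = lin_comb (\<lambda>j. a j - (if j = m then - e else 0)) (cell_indices K cs q L) zc \<sigma>"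
          unfolding lin_comb_diff using fun_cong[OF a, of \<sigma>] by (simp add: algebra_simps)
      qed
      then show ?thesis by blast
    qed
  qed
  from this[OF c, of "length cs"] show ?thesis by simp
qed

text \<open>Expand \<open>c\<close> in all columns and take boundaries. Positive columns contribute
  zero, and the other columns of \<open>R\<close> are independent by their distinct lows, so their
  coefficients vanish.\<close>

lemma cycle_eq_lin_comb:
  assumes L: "initial cs L" "L \<subseteq> cw_cells K" and c: "c \<in> cell_cycles K inc q L"
  shows "\<exists>a. c = lin_comb a {j \<in> cell_indices K cs q L. positive R j} zc"
proof -
  let ?J = "cell_indices K cs q L" let ?N = "{j \<in> ?J. \<not> positive R j}"
  have fin: "finite ?J" by (simp add: cell_indices_def)
  obtain a where a: "c = lin_comb a ?J zc"
    using chain_eq_lin_comb[OF L] c by (auto simp: cell_cycles_def)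
  have "lin_comb a ?N rc = lin_comb a ?J rc"
    using positive_iff fin by (intro lin_comb_mono_neutral) (auto simp: cell_indices_def)
  also have "\<dots> = (\<lambda>_. 0)"
    using c a by (simp add: cell_cycles_def chain_boundary_lin_comb)
  finally have z: "lin_comb a ?N rc = (\<lambda>_. 0)" .
  \<comment> \<open>Chains become functions of the position, where lows can be compared.\<close>
  let ?l = "\<lambda>j. low (col R j)" and ?w = "\<lambda>j i. rc j (cs ! i)"
  have N: "j < length cs" "\<not> positive R j" if "j \<in> ?N" for j
    using that by (auto simp: cell_indices_def)
  have "finite ?N" using fin by simp
  moreover have "inj_on ?l ?N" using low_inj N by (intro inj_onI) blast
  moreover have "?w j (?l j) \<noteq> 0" if "j \<in> ?N" for j
    using low_boundary(2)[OF N[OF that]] .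
  moreover have "?w k (?l j) = 0" if "j \<in> ?N" "k \<in> ?N" "?l k < ?l j" for j k
    using low_boundary(3)[OF N[OF that(2)] that(3) low_boundary(1)[OF N[OF that(1)]]] .
  moreover have "lin_comb a ?N ?w i = 0" for i
    using fun_cong[OF z, of "cs ! i"] by (simp add: lin_comb_def)
  ultimately have "a j = 0" if "j \<in> ?N" for j
    using that by (rule distinct_lows_independent[where l = ?l and w = ?w])
  then have "lin_comb a {j \<in> ?J. positive R j} zc = lin_comb a ?J zc"
    using fin by (intro lin_comb_mono_neutral) auto
  then show ?thesis using a by metis
qed

lemma boundary_birth_cycle_in:
  assumes "initial cs L" "k < length cs" "cs ! k \<in> L" "cw_dim K (cs ! k) = Suc q"
  shows "rc k \<in> cell_boundaries K inc q L"
  using birth_cycle_chain[OF assms(2), of L] assms unfolding cell_boundaries_def initial_def by auto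

text \<open>Serves to find the dimension of the cell that kills a given one, from the nonzero entry
  at the low.\<close>

lemma boundary_birth_cycle_dim:
  assumes "k < length cs" "rc k \<tau> \<noteq> 0"
  shows "\<tau> \<in> cw_cells K" "cw_dim K (cs ! k) = Suc (cw_dim K \<tau>)"
proof -
  obtain \<sigma> where "zc k \<sigma> * of_int (inc \<sigma> \<tau>) \<noteq> 0"
    using assms(2) unfolding chain_boundary_def by (meson sum.neutral)
  then have \<sigma>: "zc k \<sigma> \<noteq> 0" "inc \<sigma> \<tau> \<noteq> 0" by auto
  then have "cw_dim K \<sigma> = cw_dim K (cs ! k)"
    using birth_cycle_chain[OF assms(1), of UNIV] by (auto simp: cell_chains_def)
  then show "\<tau> \<in> cw_cells K" "cw_dim K (cs ! k) = Suc (cw_dim K \<tau>)"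
    using \<sigma>(2) cw(3) unfolding incidence_coefficients_def by metis+
qed

lemma initial_sublevel: "initial cs (sublevel K f t)" and initial_strict_sublevel: "initial cs (strict_sublevel K f t)"
  using filtration_mono nth_cell unfolding initial_def sublevel_def strict_sublevel_def
  by (fastforce intro: order_trans le_less_trans)+

section \<open>The classes of the birth cycles in the sublevel complex at \<open>t\<close>\<close>

context
  fixes q :: nat and t :: real
begin

text \<open>The columns with index in \<open>P\<close> span the cycles of the strict sublevel
  complex. \<open>S\<close> selects those that do not die by \<open>t\<close>, and \<open>B\<close>
  is what bounds in the sublevel complex.\<close>

private abbreviation (input) "S \<equiv> intervals_through K f cs R q t"
private abbreviation (input) "B \<equiv> cell_boundaries K inc q (sublevel K f t) :: ('a set \<Rightarrow> 'k) set"
private abbreviation (input) "P \<equiv> {j \<in> cell_indices K cs q (strict_sublevel K f t). positive R j}"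

lemma intervals_throughD:
  assumes "v \<in> S"
  shows "v \<in> P" "\<And>k. pair R v = enat k \<Longrightarrow> t < f (cs ! k)"
  using assms nth_cell
  by (auto simp: intervals_through_def persistence_intervals_def birth_def death_def
      cell_indices_def strict_sublevel_def)

text \<open>Within \<open>P\<close> the birth is before \<open>t\<close>, so an index can miss
  \<open>S\<close> only by dying by \<open>t\<close>. That birth precedes death is automatic once
  \<open>t\<close> lies strictly between them.\<close>

lemma not_intervals_throughD:
  assumes "v \<in> P" "v \<notin> S"
  obtains k where "pair R v = enat k" "f (cs ! k) \<le> t"
proof -
  have "\<not> ereal t < death f cs R v"
  proof
    assume "ereal t < death f cs R v"
    moreover have "birth f cs v < t"
      using assms(1) by (auto simp: birth_def cell_indices_def strict_sublevel_def)
    ultimately have "v \<in> S"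
      using assms(1) less_trans[of "ereal (birth f cs v)" "ereal t" "death f cs R v"]
      by (auto simp: intervals_through_def persistence_intervals_def cell_indices_def)
    with assms(2) show False by contradiction
  qed
  then show thesis using that by (cases "pair R v") (auto simp: death_def)
qed

lemma finite_intervals_through: "finite S"
  by (simp add: intervals_through_def persistence_intervals_def)

lemma birth_cycle_cycle:
  assumes "v \<in> P"
  shows "zc v \<in> cell_cycles K inc q (strict_sublevel K f t)"
  using assms birth_cycle_chain[of v "strict_sublevel K f t"] initial_strict_sublevel[of t] positive_iff
  by (auto simp: cell_cycles_def cell_indices_def initial_def)

text \<open>A bounding combination is a relation between cycles \<open>zc v\<close>, with last
  position \<open>v\<close>, and boundaries \<open>rc j\<close>, with last position the low of
  column \<open>j\<close>. All these positions are distinct.\<close>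

lemma birth_cycles_independent:
  assumes "lin_comb a S zc \<in> B" "v \<in> S"
  shows "a v = 0"
proof -
  let ?J = "cell_indices K cs (Suc q) (sublevel K f t)" let ?N = "{j \<in> ?J. \<not> positive R j}"
  have fin: "finite ?J" by (simp add: cell_indices_def)
  obtain c where c: "c \<in> cell_chains K (Suc q) (sublevel K f t)" "lin_comb a S zc = chain_boundary K inc c"
    using assms(1) by (auto simp: cell_boundaries_def)
  obtain b where b: "c = lin_comb b ?J zc"
    using chain_eq_lin_comb[OF initial_sublevel _ c(1)] by (auto simp: sublevel_def)
  have "lin_comb b ?N rc = lin_comb b ?J rc"
    using positive_iff fin by (intro lin_comb_mono_neutral) (auto simp: cell_indices_def)
  then have ab: "lin_comb a S zc = lin_comb b ?N rc"
    using c(2) b by (simp add: chain_boundary_lin_comb)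
  have S: "j < length cs" "positive R j" if "j \<in> S" for j
    using intervals_throughD(1)[OF that] by (auto simp: cell_indices_def)
  have N: "j < length cs" "\<not> positive R j" "f (cs ! j) \<le> t" if "j \<in> ?N" for j
    using that by (auto simp: cell_indices_def sublevel_def)
  \<comment> \<open>The two families are merged into one: positivity of the index tells them apart,
    and the boundaries enter with a minus sign.\<close>
  let ?l = "\<lambda>j. if positive R j then j else low (col R j)"
  let ?w = "\<lambda>j i. (if positive R j then zc j else rc j) (cs ! i)"
  let ?a = "\<lambda>j. if positive R j then a j else - b j"
  have ll: "?l j < length cs" "?w j (?l j) \<noteq> 0" "\<And>i. ?l j < i \<Longrightarrow> i < length cs \<Longrightarrow> ?w j i = 0"
    if "j \<in> S \<union> ?N" for j
  proof -
    have j: "j < length cs" using that S N by blast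
    have "?l j < length cs \<and> ?w j (?l j) \<noteq> 0 \<and> (\<forall>i. ?l j < i \<longrightarrow> i < length cs \<longrightarrow> ?w j i = 0)"
    proof (cases "positive R j")
      case True
      then show ?thesis using j birth_cycle_diag birth_cycle_above by simp
    next
      case False
      then show ?thesis using low_boundary[OF j False] by simp
    qed
    then show "?l j < length cs" "?w j (?l j) \<noteq> 0" "\<And>i. ?l j < i \<Longrightarrow> i < length cs \<Longrightarrow> ?w j i = 0"
      by blast+
  qed
  have "finite (S \<union> ?N)" using fin finite_intervals_through by simp
  moreover have "inj_on ?l (S \<union> ?N)"
  proof -
    \<comment> \<open>If \<open>j\<close> were the low of column \<open>k\<close>, it would be
      paired with \<open>k\<close> and die by \<open>t\<close>, whereas indices in \<open>S\<close>
      die later or never.\<close>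
    have ne: "low (col R k) \<noteq> j" if "j \<in> S" "k \<in> ?N" for j k
    proof
      assume "low (col R k) = j"
      then have "pair R j = enat k" by (rule pair_eq[OF N(1,2)[OF that(2)]])
      then show False using intervals_throughD(2)[OF that(1)] N(3)[OF that(2)] by (meson not_le)
    qed
    show ?thesis
    proof (rule inj_onI)
      fix j k assume jk: "j \<in> S \<union> ?N" "k \<in> S \<union> ?N" "?l j = ?l k"
      have P: "i \<in> S" if "i \<in> S \<union> ?N" "positive R i" for i using that N(2) by blast
      have P': "i \<in> ?N" if "i \<in> S \<union> ?N" "\<not> positive R i" for i using that S(2) by blast
      show "j = k"
      proof (cases "positive R j"; cases "positive R k")
        assume "positive R j" "positive R k"
        then show ?thesis using jk(3) by simp
      next
        assume p: "positive R j" "\<not> positive R k"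
        then show ?thesis using jk(3) ne[OF P[OF jk(1) p(1)] P'[OF jk(2) p(2)]] by simp
      next
        assume p: "\<not> positive R j" "positive R k"
        then show ?thesis using jk(3) ne[OF P[OF jk(2) p(2)] P'[OF jk(1) p(1)]] by simp
      next
        assume p: "\<not> positive R j" "\<not> positive R k"
        then show ?thesis
          using jk(3) low_inj[OF N(1)[OF P'[OF jk(1) p(1)]] N(1)[OF P'[OF jk(2) p(2)]]] by simp
      qed
    qed
  qed
  moreover have "?w j (?l j) \<noteq> 0" if "j \<in> S \<union> ?N" for j using ll(2)[OF that] .
  moreover have "?w k (?l j) = 0" if "j \<in> S \<union> ?N" "k \<in> S \<union> ?N" "?l k < ?l j" for j k
    using ll(3)[OF that(2,3) ll(1)[OF that(1)]] .
  moreover have "lin_comb ?a (S \<union> ?N) ?w i = 0" for i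
  proof -
    have "lin_comb ?a (S \<union> ?N) ?w i = lin_comb ?a S ?w i + lin_comb ?a ?N ?w i"
      unfolding lin_comb_def using S(2) fin finite_intervals_through
      by (intro sum.union_disjoint) auto
    also have "lin_comb ?a S ?w i = lin_comb a S zc (cs ! i)"
      unfolding lin_comb_def using S(2) by (intro sum.cong) auto
    also have "lin_comb ?a ?N ?w i = - lin_comb b ?N rc (cs ! i)"
      unfolding lin_comb_def sum_negf[symmetric] by (intro sum.cong) auto
    finally show ?thesis by (simp add: ab)
  qed
  moreover have "v \<in> S \<union> ?N" using assms(2) by simp
  ultimately have "?a v = 0" by (rule distinct_lows_independent[where l = ?l and w = ?w])
  then show ?thesis using S(2)[OF assms(2)] by simp
qed

text \<open>Isolated as a predicate because it cuts out a subspace, so that it suffices to treat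
  generators.\<close>

definition spanned :: "('a set \<Rightarrow> 'k) \<Rightarrow> bool" where
  "spanned c \<longleftrightarrow> (\<exists>a. (\<lambda>\<sigma>. c \<sigma> - lin_comb a S zc \<sigma>) \<in> B)"

lemma fun_subspace_spanned: "fun_subspace (Collect spanned)"
  unfolding fun_subspace_def
proof (intro conjI ballI allI)
  note D = fun_subspaceD[OF fun_subspace_cell_boundaries[of K inc q "sublevel K f t"]]
  have 0: "spanned (\<lambda>_. 0)"
    unfolding spanned_def by (intro exI[of _ "\<lambda>_. 0"]) (simp add: lin_comb_def D(1))
  then show "(\<lambda>_. 0) \<in> Collect spanned" by simp
  fix x y :: "'a set \<Rightarrow> 'k" and r
  assume "x \<in> Collect spanned"
  then obtain a where a: "(\<lambda>\<sigma>. x \<sigma> - lin_comb a S zc \<sigma>) \<in> B" by (auto simp: spanned_def)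
  have "(\<lambda>\<sigma>. r * x \<sigma> - lin_comb (\<lambda>v. r * a v) S zc \<sigma>) = (\<lambda>\<sigma>. r * (x \<sigma> - lin_comb a S zc \<sigma>))"
    by (simp add: lin_comb_def sum_distrib_left right_diff_distrib mult.assoc)
  then have "spanned (\<lambda>\<sigma>. r * x \<sigma>)"
    unfolding spanned_def using D(3)[OF a, of r] by (intro exI[of _ "\<lambda>v. r * a v"]) simp
  then show "(\<lambda>\<sigma>. r * x \<sigma>) \<in> Collect spanned" by simp
  assume "y \<in> Collect spanned"
  then obtain b where b: "(\<lambda>\<sigma>. y \<sigma> - lin_comb b S zc \<sigma>) \<in> B" by (auto simp: spanned_def)
  have "(\<lambda>\<sigma>. x \<sigma> + y \<sigma> - lin_comb (\<lambda>v. a v + b v) S zc \<sigma>)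
      = (\<lambda>\<sigma>. (x \<sigma> - lin_comb a S zc \<sigma>) + (y \<sigma> - lin_comb b S zc \<sigma>))"
    by (simp add: lin_comb_def sum.distrib algebra_simps)
  then have "spanned (\<lambda>\<sigma>. x \<sigma> + y \<sigma>)"
    unfolding spanned_def using D(2)[OF a b] by (intro exI[of _ "\<lambda>v. a v + b v"]) simp
  then show "(\<lambda>\<sigma>. x \<sigma> + y \<sigma>) \<in> Collect spanned" by simp
qed

text \<open>Strong induction on the index. A cycle from \<open>S\<close> represents itself; any
  other is, modulo a boundary, a cycle supported before \<open>j\<close> and so a combination of
  earlier birth cycles.\<close>

lemma birth_cycle_spanned:
  "j \<in> P \<Longrightarrow> spanned (zc j)"
proof (induction j rule: less_induct)
  case (less j)
  show ?case
  proof (cases "j \<in> S")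
    case True
    have "lin_comb (\<lambda>v. if v = j then 1 else 0) S zc = zc j"
      using True finite_intervals_through by (auto simp: lin_comb_def if_distrib[of "\<lambda>x. x * _"] cong: if_cong)
    then show ?thesis
      unfolding spanned_def using fun_subspaceD(1)[OF fun_subspace_cell_boundaries]
      by (intro exI[of _ "\<lambda>v. if v = j then 1 else 0"]) simp
  next
    case False
    obtain k where k: "pair R j = enat k" "f (cs ! k) \<le> t"
      using not_intervals_throughD[OF less.prems False] .
    note kl = pair_enatD[OF k(1)]
    have j: "j < length cs" "positive R j" "cw_dim K (cs ! j) = q" "cs ! j \<in> strict_sublevel K f t"
      using less.prems by (auto simp: cell_indices_def)
    \<comment> \<open>The last nonzero coefficient of the boundary \<open>rc k\<close>, found at its
      low \<open>j\<close>.\<close>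
    define e where "e = rc k (cs ! j)"
    have e: "e \<noteq> 0" using low_boundary(2)[OF kl(1,2)] kl(3) by (simp add: e_def)
    then have dim: "cw_dim K (cs ! k) = Suc q"
      using boundary_birth_cycle_dim(2)[OF kl(1), of "cs ! j"] j(3) by (simp add: e_def)
    \<comment> \<open>The killing cell has entered by \<open>t\<close>, so its column bounds in the
      sublevel complex even if its index exceeds \<open>j\<close>.\<close>
    have rB: "rc k \<in> B"
      using kl(1) k(2) nth_cell dim by (intro boundary_birth_cycle_in initial_sublevel) (auto simp: sublevel_def)
    let ?L = "(!) cs ` {..<j}"
    \<comment> \<open>Dividing by \<open>e\<close> makes the terms at \<open>j\<close> cancel; both
      chains vanish at later positions.\<close>
    let ?y = "\<lambda>\<sigma>. zc j \<sigma> - inverse e * rc k \<sigma>"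
    have "?y \<in> cell_cycles K inc q ?L"
      unfolding cell_cycles_def
    proof (intro CollectI conjI)
      have "?y \<sigma> = 0" if "\<not> (\<sigma> \<in> ?L \<and> cw_dim K \<sigma> = q)" for \<sigma>
      proof (cases "\<sigma> \<in> cw_cells K")
        case True
        then obtain i where i: "i < length cs" "\<sigma> = cs ! i" using cell_eq_nth by blast
        consider "i < j" | "i = j" | "j < i" by linarith
        then show ?thesis
        proof cases
          case 1
          \<comment> \<open>The cell precedes \<open>j\<close>, so only a wrong dimension can
            exclude it.\<close>
          then have d: "cw_dim K \<sigma> \<noteq> q" using that i by auto
          then have "zc j \<sigma> = 0"
            using birth_cycle_chain[OF j(1), of UNIV] j(3) by (auto simp: cell_chains_def)
          moreover have "rc k \<sigma> = 0"
            using boundary_birth_cycle_dim(2)[OF kl(1), of \<sigma>] d dim by auto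
          ultimately show ?thesis by simp
        next
          case 2
          then show ?thesis using i j birth_cycle_diag[of j] e by (simp add: e_def)
        next
          case 3
          then show ?thesis using i kl low_boundary(3)[OF kl(1,2), of i] birth_cycle_above[of j i] by simp
        qed
      next
        case False
        then show ?thesis by (simp add: birth_cycle_outside chain_boundary_outside)
      qed
      then show "?y \<in> cell_chains K q ?L" unfolding cell_chains_def by blast
      \<comment> \<open>The birth cycle has zero boundary, and \<open>rc k\<close>, being a boundary
        itself, is a cycle.\<close>
      have "chain_boundary K inc (\<lambda>\<sigma>. zc j \<sigma> + (- inverse e) * rc k \<sigma>) = (\<lambda>_. 0)"
        unfolding chain_boundary_add chain_boundary_smult chain_boundary_squared[OF cw]
        using positive_iff[OF j(1)] j(2) by simp
      then show "chain_boundary K inc ?y = (\<lambda>_. 0)" by simp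
    qed
    moreover have "initial cs ?L"
      using j(1) nth_eq_iff_index_eq[OF distinct_cells] by (fastforce simp: initial_def)
    moreover have "?L \<subseteq> cw_cells K" using nth_cell j(1) by auto
    ultimately obtain a where a: "?y = lin_comb a {i \<in> cell_indices K cs q ?L. positive R i} zc"
      using cycle_eq_lin_comb by blast
    have "spanned ?y"
      unfolding a
    proof (rule lin_comb_in_subspace[OF fun_subspace_spanned, unfolded mem_Collect_eq])
      fix i assume i: "i \<in> {i \<in> cell_indices K cs q ?L. positive R i}"
      then have "i < j"
        using j(1) nth_eq_iff_index_eq[OF distinct_cells] by (auto simp: cell_indices_def)
      \<comment> \<open>The strict sublevel is initial, so earlier positive indices of dimension
        \<open>q\<close> stay in \<open>P\<close> and fall under the induction hypothesis.\<close>
      moreover from this have "i \<in> P"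
        using i j(1,4) initial_strict_sublevel[of t] by (auto simp: cell_indices_def initial_def)
      ultimately show "spanned (zc i)" by (rule less.IH)
    qed
    moreover have "spanned (\<lambda>\<sigma>. inverse e * rc k \<sigma>)"
      unfolding spanned_def using fun_subspaceD(3)[OF fun_subspace_cell_boundaries rB]
      by (intro exI[of _ "\<lambda>_. 0"]) (simp add: lin_comb_def)
    ultimately have "spanned (\<lambda>\<sigma>. ?y \<sigma> + inverse e * rc k \<sigma>)"
      using fun_subspaceD(2)[OF fun_subspace_spanned, of ?y "\<lambda>\<sigma>. inverse e * rc k \<sigma>"] by simp
    then show ?thesis by simp
  qed
qed

lemma cycle_spanned:
  assumes "c \<in> cell_cycles K inc q (strict_sublevel K f t)"
  shows "\<exists>a. (\<lambda>\<sigma>. c \<sigma> - lin_comb a S zc \<sigma>) \<in> B"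
proof -
  obtain a where a: "c = lin_comb a P zc"
    using cycle_eq_lin_comb[OF initial_strict_sublevel _ assms] by (auto simp: strict_sublevel_def)
  have "spanned c"
    unfolding a using birth_cycle_spanned
    by (intro lin_comb_in_subspace[OF fun_subspace_spanned, unfolded mem_Collect_eq]) blast
  then show ?thesis by (simp add: spanned_def)
qed

end
end

section \<open>The image of the inclusion\<close>

lemma homology_class_eq_fun_coset:
  "homology_class K inc q L = fun_coset (cell_boundaries K inc q L)"
  by (simp add: fun_eq_iff homology_class_def fun_coset_def)

text \<open>The union in \<open>inclusion_induced\<close> runs over representatives that differ by
  boundaries of the smaller complex. These also bound in the larger one, so all its members
  coincide.\<close>

lemma inclusion_induced_homology_class:
  assumes "L' \<subseteq> L"
  shows "inclusion_induced K inc q L (homology_class K inc q L' z) = homology_class K inc q L z"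
proof -
  note B = fun_subspace_cell_boundaries
  have sub: "cell_boundaries K inc q L' \<subseteq> cell_boundaries K inc q L"
    using assms unfolding cell_boundaries_def cell_chains_def by (intro image_mono) auto
  have "homology_class K inc q L x = homology_class K inc q L z" if x: "x \<in> homology_class K inc q L' z" for x
  proof -
    obtain b where b: "b \<in> cell_boundaries K inc q L'" "x = (\<lambda>\<sigma>. z \<sigma> + b \<sigma>)"
      using x by (auto simp: homology_class_def)
    then have "(\<lambda>\<sigma>. x \<sigma> - z \<sigma>) \<in> cell_boundaries K inc q L" using sub by auto
    then show ?thesis unfolding homology_class_eq_fun_coset fun_coset_eq_iff[OF B] .
  qed
  moreover have "z \<in> homology_class K inc q L' z"
    unfolding homology_class_eq_fun_coset by (rule fun_cosetI[OF fun_subspaceD(1)[OF B]]) simp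
  ultimately show ?thesis unfolding inclusion_induced_def by blast
qed

text \<open>\<open>basis\<close> speaks of a set of classes, so injectivity is stated beside it:
  different intervals give different classes. The image is made a vector space by restricting the
  carrier of the homology module.\<close>

theorem corollary3p1:
  fixes K :: "'a cw_complex"
    and inc :: "'a set \<Rightarrow> 'a set \<Rightarrow> int"
    and f :: "'a set \<Rightarrow> real"
    and cs :: "'a set list"
    and R V :: "'k::field mat"
    and q :: nat
    and t :: real
  assumes "finite_cw_complex K"
    and "oriented_cells K"
    and "incidence_coefficients K inc"
    and "filtration_function K f"
    and "filtration_order K f cs"
    and "V \<in> carrier_mat (length cs) (length cs)"
    and "upper_unitriangular V"
    and "dimension_preserving K cs V"
    and "R = boundary_matrix inc cs * V"
    and "reduced_matrix R"
    and "t \<in> f ` cw_cells K"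
  shows "let S = intervals_through K f cs R q t;
             cls = (\<lambda>v. homology_class K inc q (sublevel K f t) (birth_cycle cs V v));
             H_before = cellular_homology K inc q (strict_sublevel K f t);
             H = cellular_homology K inc q (sublevel K f t);
             image_i = inclusion_induced K inc q (sublevel K f t) ` carrier H_before
         in inj_on cls S \<and> vectorspace.basis class_ring (H\<lparr>carrier := image_i\<rparr>) (cls ` S)"
proof -
  let ?B = "cell_boundaries K inc q (sublevel K f t) :: ('a set \<Rightarrow> 'k) set"
  let ?Z = "cell_cycles K inc q (strict_sublevel K f t) :: ('a set \<Rightarrow> 'k) set"
  let ?S = "intervals_through K f cs R q t"
  let ?image = "inclusion_induced K inc q (sublevel K f t) ` carrier (cellular_homology K inc q (strict_sublevel K f t))"
  let ?M = "(cellular_homology K inc q (sublevel K f t))\<lparr>carrier := ?image\<rparr>"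
  note ctx = assms(1-3,5-10)
  \<comment> \<open>The image consists of the cycles of the strict sublevel complex modulo the
    boundaries of the sublevel complex, the form that \<open>quotient_basis\<close> handles.\<close>
  have image: "?image = fun_coset ?B ` ?Z"
  proof -
    have "strict_sublevel K f t \<subseteq> sublevel K f t" by (auto simp: strict_sublevel_def sublevel_def)
    then show ?thesis
      by (simp add: cellular_homology_def image_image inclusion_induced_homology_class)
        (simp only: homology_class_eq_fun_coset)
  qed
  have "inj_on (\<lambda>v. fun_coset ?B (birth_cycle cs V v)) ?S \<and>
      vectorspace.basis class_ring ?M ((\<lambda>v. fun_coset ?B (birth_cycle cs V v)) ` ?S)"
  proof (rule quotient_basis[where Z = ?Z])
    show "finite ?S" by (rule finite_intervals_through[OF ctx])
    show "birth_cycle cs V v \<in> ?Z" if "v \<in> ?S" for v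
      using birth_cycle_cycle[OF ctx intervals_throughD(1)[OF ctx that]] .
    show "a v = 0" if "lin_comb a ?S (birth_cycle cs V) \<in> ?B" "v \<in> ?S" for a v
      using birth_cycles_independent[OF ctx that] .
    show "\<exists>a. (\<lambda>\<sigma>. c \<sigma> - lin_comb a ?S (birth_cycle cs V) \<sigma>) \<in> ?B" if "c \<in> ?Z" for c
      using cycle_spanned[OF ctx that] .
    show "carrier ?M = fun_coset ?B ` ?Z" by (simp only: image) simp
  qed (simp_all add: cellular_homology_def fun_subspace_cell_boundaries fun_subspace_cell_cycles)
  then show ?thesis
    unfolding Let_def homology_class_eq_fun_coset .
qed

end
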